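(* Let $\gamma\in(0,1)$ and $z_0=(x_0,y_0)\in(0,\infty)^2$. For $\alpha\in[0,\pi/2]$ we have $$L_1(q(\alpha))=e^{p(\alpha)x_0+q(\alpha)y_0}\,\mathbb{P}^\alpha(T_1<T_2)=\sum_{n\le-1}(-1)^{n+1}e^{p_nx_0+q_ny_0}$$ and $$L_2(p(\alpha))=e^{p(\alpha)x_0+q(\alpha)y_0}\,\mathbb{P}^\alpha(T_2<T_1)=\sum_{n\ge1}(-1)^{n+1}e^{p_nx_0+q_ny_0},$$ where $(p_0,q_0)=(p(\alpha),q(\alpha))$ and the sequence $(p_n,q_n)_{n\in\mathbb{Z}}$ is defined, for all $n\in\mathbb{Z}$, by $$p_{2n}=p_0+2n(p_0-q_0)-2n(n+\gamma),\quad q_{2n}=q_0+2n(p_0-q_0)-2n(n+\gamma-1),\quad(p_{2n+1},q_{2n+1})=(p_{2n},q_{2n+2}).$$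
   Context: Let $W$ be a standard one-dimensional Brownian motion, and let $Z(t)=(X(t),Y(t))=z_0+\mathbf{W}(t)+\mu t$ with $\mathbf{W}(t)=(-W(t),W(t))$ and $\mu=(1-\gamma,\gamma)$. Let $T_1=\inf\{t\ge0: Z(t)\in\{0\}\times\mathbb{R}_+\}$ and $T_2=\inf\{t\ge0: Z(t)\in\mathbb{R}_+\times\{0\}\}$. For $\alpha\in(0,\pi/2)$, $(p(\alpha),q(\alpha))=\left(\frac{\gamma^2}{2}-\frac{1}{2(1+1/\tan\alpha)^2},\ \frac{(1-\gamma)^2}{2}-\frac{1}{2(1+\tan\alpha)^2}\right)$, extended by limits: $(p(0),q(0))=(\gamma^2/2,-\gamma+\gamma^2/2)$ and $(p(\pi/2),q(\pi/2))=((\gamma^2-1)/2,(1-\gamma)^2/2)$. $\mathbb{P}^\alpha$ is the probability obtained from $\mathbb{P}$ by Doob's $h$-transform with the harmonic function $(x,y)\mapsto e^{xp(\alpha)+yq(\alpha)}$: on the $\sigma$-field generated by $(W(s))_{s\le t}$ it has density $e^{(p(\alpha),q(\alpha))\cdot(\mathbf{W}(t)+\mu t)}$ with respect to $\mathbb{P}$. Laplace transforms: $L_1(q)=\mathbb{E}(e^{qY(T_1)}\mathbf{1}_{T_1<T_2})$ for $\Re q<0$, $L_2(p)=\mathbb{E}(e^{pX(T_2)}\mathbf{1}_{T_2<T_1})$ for $\Re p<0$. With $P^-(q)=\gamma-1+q-\sqrt{(1-\gamma)^2-2q}$ and $Q^-(p)=-\gamma+p-\sqrt{\gamma^2-2p}$,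 they are continued by $L_1(q)=e^{P^-(q)x_0+qy_0}-L_2(P^-(q))$ for $\Re q<(1-\gamma)^2/2$ and $L_2(p)=e^{px_0+Q^-(p)y_0}-L_1(Q^-(p))$ for $\Re p<\gamma^2/2$; the same formulas give the values at $q=(1-\gamma)^2/2$ and $p=\gamma^2/2$. *)

theory Defs
  imports "HOL-Probability.Probability"
begin

definition brownian_motion :: "'a measure \<Rightarrow> (real \<Rightarrow> 'a \<Rightarrow> real) \<Rightarrow> bool" where
  "brownian_motion M W \<longleftrightarrow>
     prob_space M \<and>
     (\<forall>t\<ge>0. W t \<in> borel_measurable M) \<and>
     (\<forall>\<omega>\<in>space M. W 0 \<omega> = 0 \<and> continuous_on {0..} (\<lambda>t. W t \<omega>)) \<and>
     (\<forall>s t. 0 \<le> s \<longrightarrow> s < t \<longrightarrow>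
        distributed M lborel (\<lambda>\<omega>. W t \<omega> - W s \<omega>) (normal_density 0 (sqrt (t - s)))) \<and>
     (\<forall>(\<tau> :: nat \<Rightarrow> real) n. 0 \<le> \<tau> 0 \<longrightarrow> (\<forall>i<n. \<tau> i < \<tau> (Suc i)) \<longrightarrow>
        prob_space.indep_vars M (\<lambda>_. borel) (\<lambda>i \<omega>. W (\<tau> (Suc i)) \<omega> - W (\<tau> i) \<omega>) {..<n})"

definition generated_sets :: "'a set \<Rightarrow> (real \<Rightarrow> 'a \<Rightarrow> real) \<Rightarrow> real set \<Rightarrow> 'a set set" where
  "generated_sets \<Omega> W I = sigma_sets \<Omega> {W s -` B \<inter> \<Omega> | s B. s \<in> I \<and> B \<in> sets borel}"

text \<open>The displacement \<open>\<^bold>W(t) + \<mu> t\<close> with \<open>\<^bold>W = (-W, W)\<close>, \<open>\<mu> = (1 - \<gamma>, \<gamma>)\<close>.\<close>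

definition displacement :: "(real \<Rightarrow> 'a \<Rightarrow> real) \<Rightarrow> real \<Rightarrow> real \<Rightarrow> 'a \<Rightarrow> real \<times> real" where
  "displacement W \<gamma> t \<omega> = (- W t \<omega>, W t \<omega>) + t *\<^sub>R (1 - \<gamma>, \<gamma>)"

definition Z :: "(real \<Rightarrow> 'a \<Rightarrow> real) \<Rightarrow> real \<Rightarrow> real \<times> real \<Rightarrow> real \<Rightarrow> 'a \<Rightarrow> real \<times> real" where
  "Z W \<gamma> z0 t \<omega> = z0 + displacement W \<gamma> t \<omega>"

text \<open>Hitting times of the two axes; they are \<open>\<infinity>\<close> when the axis is never hit.\<close>

definition T1 :: "(real \<Rightarrow> 'a \<Rightarrow> real) \<Rightarrow> real \<Rightarrow> real \<times> real \<Rightarrow> 'a \<Rightarrow> ereal" where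
  "T1 W \<gamma> z0 \<omega> = Inf (ereal ` {t. 0 \<le> t \<and> Z W \<gamma> z0 t \<omega> \<in> {0} \<times> {0..}})"

definition T2 :: "(real \<Rightarrow> 'a \<Rightarrow> real) \<Rightarrow> real \<Rightarrow> real \<times> real \<Rightarrow> 'a \<Rightarrow> ereal" where
  "T2 W \<gamma> z0 \<omega> = Inf (ereal ` {t. 0 \<le> t \<and> Z W \<gamma> z0 t \<omega> \<in> {0..} \<times> {0}})"

text \<open>The end points are separate cases because \<open>1 / tan 0 = 0\<close> and \<open>tan (pi/2) = 0\<close> in HOL.\<close>

definition p_par :: "real \<Rightarrow> real \<Rightarrow> real" where
  "p_par \<gamma> \<alpha> =
     (if \<alpha> = 0 then \<gamma>\<^sup>2 / 2
      else if \<alpha> = pi / 2 then (\<gamma>\<^sup>2 - 1) / 2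
      else \<gamma>\<^sup>2 / 2 - 1 / (2 * (1 + 1 / tan \<alpha>)\<^sup>2))"

definition q_par :: "real \<Rightarrow> real \<Rightarrow> real" where
  "q_par \<gamma> \<alpha> =
     (if \<alpha> = 0 then - \<gamma> + \<gamma>\<^sup>2 / 2
      else if \<alpha> = pi / 2 then (1 - \<gamma>)\<^sup>2 / 2
      else (1 - \<gamma>)\<^sup>2 / 2 - 1 / (2 * (1 + tan \<alpha>)\<^sup>2))"

text \<open>\<open>P\<close> is the h-transform of \<open>M\<close> for \<open>h(x,y) = exp (x p(\<alpha>) + y q(\<alpha>))\<close>.  The density is
  only prescribed on each \<open>\<sigma>(W(s), s \<le> t)\<close>; globally \<open>P\<close> is in general singular to \<open>M\<close>.
  These values determine \<open>P\<close> on \<open>\<sigma>(W(s), s \<ge> 0)\<close>.\<close>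

definition doob_transform ::
  "'a measure \<Rightarrow> (real \<Rightarrow> 'a \<Rightarrow> real) \<Rightarrow> real \<Rightarrow> real \<Rightarrow> 'a measure \<Rightarrow> bool" where
  "doob_transform M W \<gamma> \<alpha> P \<longleftrightarrow>
     prob_space P \<and> space P = space M \<and> generated_sets (space M) W {0..} \<subseteq> sets P \<and>
     (\<forall>t\<ge>0. \<forall>A \<in> generated_sets (space M) W {0..t}.
        emeasure P A =
        emeasure (density M (\<lambda>\<omega>. ennreal (exp ((p_par \<gamma> \<alpha>, q_par \<gamma> \<alpha>) \<bullet> displacement W \<gamma> t \<omega>)))) A)"

text \<open>\<open>laplace1\<close> and \<open>laplace2\<close> are the expectations themselves, to be used at arguments with
  negative real part; \<open>L1\<close> and \<open>L2\<close> are their continuations.\<close>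

definition laplace1 ::
  "'a measure \<Rightarrow> (real \<Rightarrow> 'a \<Rightarrow> real) \<Rightarrow> real \<Rightarrow> real \<times> real \<Rightarrow> complex \<Rightarrow> complex" where
  "laplace1 M W \<gamma> z0 q =
     (\<integral>\<omega>. exp (q * complex_of_real (snd (Z W \<gamma> z0 (real_of_ereal (T1 W \<gamma> z0 \<omega>)) \<omega>)))
          * indicator {\<omega>. T1 W \<gamma> z0 \<omega> < T2 W \<gamma> z0 \<omega>} \<omega> \<partial>M)"

definition laplace2 ::
  "'a measure \<Rightarrow> (real \<Rightarrow> 'a \<Rightarrow> real) \<Rightarrow> real \<Rightarrow> real \<times> real \<Rightarrow> complex \<Rightarrow> complex" where
  "laplace2 M W \<gamma> z0 p =
     (\<integral>\<omega>. exp (p * complex_of_real (fst (Z W \<gamma> z0 (real_of_ereal (T2 W \<gamma> z0 \<omega>)) \<omega>)))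
          * indicator {\<omega>. T2 W \<gamma> z0 \<omega> < T1 W \<gamma> z0 \<omega>} \<omega> \<partial>M)"

definition P_minus :: "real \<Rightarrow> complex \<Rightarrow> complex" where
  "P_minus \<gamma> q = of_real \<gamma> - 1 + q - csqrt ((1 - of_real \<gamma>)\<^sup>2 - 2 * q)"

definition Q_minus :: "real \<Rightarrow> complex \<Rightarrow> complex" where
  "Q_minus \<gamma> p = - of_real \<gamma> + p - csqrt ((of_real \<gamma>)\<^sup>2 - 2 * p)"

text \<open>For \<open>0 < \<gamma> < 1\<close>, \<open>Re (P_minus \<gamma> q) < 0\<close> whenever \<open>Re q \<le> (1 - \<gamma>)\<^sup>2 / 2\<close> and
  \<open>Re (Q_minus \<gamma> p) < 0\<close> whenever \<open>Re p \<le> \<gamma>\<^sup>2 / 2\<close>, so the continuation formulas only use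
  expectations at arguments with negative real part.  Values of \<open>L1\<close>, \<open>L2\<close> beyond these
  half-planes have no meaning.\<close>

definition L1 ::
  "'a measure \<Rightarrow> (real \<Rightarrow> 'a \<Rightarrow> real) \<Rightarrow> real \<Rightarrow> real \<times> real \<Rightarrow> complex \<Rightarrow> complex" where
  "L1 M W \<gamma> z0 q =
     (if Re q < 0 then laplace1 M W \<gamma> z0 q
      else exp (P_minus \<gamma> q * of_real (fst z0) + q * of_real (snd z0))
           - laplace2 M W \<gamma> z0 (P_minus \<gamma> q))"

definition L2 ::
  "'a measure \<Rightarrow> (real \<Rightarrow> 'a \<Rightarrow> real) \<Rightarrow> real \<Rightarrow> real \<times> real \<Rightarrow> complex \<Rightarrow> complex" where
  "L2 M W \<gamma> z0 p =
     (if Re p < 0 then laplace2 M W \<gamma> z0 p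
      else exp (p * of_real (fst z0) + Q_minus \<gamma> p * of_real (snd z0))
           - laplace1 M W \<gamma> z0 (Q_minus \<gamma> p))"

definition p_even :: "real \<Rightarrow> real \<Rightarrow> int \<Rightarrow> real" where
  "p_even \<gamma> \<alpha> n = p_par \<gamma> \<alpha> + 2 * of_int n * (p_par \<gamma> \<alpha> - q_par \<gamma> \<alpha>)
                   - 2 * of_int n * (of_int n + \<gamma>)"

definition q_even :: "real \<Rightarrow> real \<Rightarrow> int \<Rightarrow> real" where
  "q_even \<gamma> \<alpha> n = q_par \<gamma> \<alpha> + 2 * of_int n * (p_par \<gamma> \<alpha> - q_par \<gamma> \<alpha>)
                   - 2 * of_int n * (of_int n + \<gamma> - 1)"

definition p_seq :: "real \<Rightarrow> real \<Rightarrow> int \<Rightarrow> real" where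
  "p_seq \<gamma> \<alpha> n = p_even \<gamma> \<alpha> (n div 2)"

definition q_seq :: "real \<Rightarrow> real \<Rightarrow> int \<Rightarrow> real" where
  "q_seq \<gamma> \<alpha> n = (if even n then q_even \<gamma> \<alpha> (n div 2) else q_even \<gamma> \<alpha> (n div 2 + 1))"

lemma p_q_seq_simps:
  "p_seq \<gamma> \<alpha> 0 = p_par \<gamma> \<alpha>"
  "q_seq \<gamma> \<alpha> 0 = q_par \<gamma> \<alpha>"
  "p_seq \<gamma> \<alpha> (2 * n) = p_even \<gamma> \<alpha> n"
  "q_seq \<gamma> \<alpha> (2 * n) = q_even \<gamma> \<alpha> n"
  "p_seq \<gamma> \<alpha> (2 * n + 1) = p_seq \<gamma> \<alpha> (2 * n)"
  "q_seq \<gamma> \<alpha> (2 * n + 1) = q_seq \<gamma> \<alpha> (2 * n + 2)"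
  by (simp_all add: p_seq_def q_seq_def p_even_def q_even_def)

end

theory Submission
  imports Defs "HOL-Real_Asymp.Real_Asymp"
begin

text \<open>Along every path \<open>X(t) + Y(t) = x0 + y0 + t\<close>, so \<open>T1\<close> and \<open>T2\<close> are the times at which the
one-dimensional Brownian motion \<open>W\<close> first meets the line \<open>x0 + (1 - \<gamma>) t\<close> and the line
\<open>- y0 - \<gamma> t\<close>, and the value of \<open>Y\<close> at \<open>T1\<close> is \<open>x0 + y0 + T1\<close>.

The function \<open>exp (x p + y q)\<close> is harmonic for \<open>Z\<close> exactly on a parabola of pairs \<open>(p, q)\<close>, which the
drift shift parametrizes: \<open>p(\<sigma>) = (\<gamma>\<^sup>2 - \<sigma>\<^sup>2) / 2\<close> and
\<open>q(\<sigma>) = ((1 - \<gamma>)\<^sup>2 - (1 - \<sigma>)\<^sup>2) / 2\<close>.  With \<open>E(\<sigma>) = exp (p(\<sigma>) x0 + q(\<sigma>) y0)\<close>, the process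
\<open>exp (p(\<sigma>) X(t) + q(\<sigma>) Y(t))\<close> is \<open>E(\<sigma>)\<close> times the exponential martingale of \<open>W\<close> with parameter
\<open>\<sigma> - \<gamma>\<close>, that is, the density under which \<open>W\<close> gets the drift \<open>\<sigma> - \<gamma>\<close>.  The pair
\<open>(p(\<alpha>), q(\<alpha>))\<close> is the point \<open>s = tan \<alpha> / (1 + tan \<alpha>)\<close> of \<open>[0, 1]\<close>.

If \<open>\<sigma> \<ge> 1\<close> or \<open>\<sigma> \<le> 0\<close>, then the tilted motion drifts at least as fast as one of the two lines and
leaves the quadrant almost surely.  Optional stopping then loses no mass at infinity and gives
\<open>E(\<sigma>) = \<Phi>1(q(\<sigma>)) + \<Phi>2(p(\<sigma>))\<close> (lemma \<open>exit_balance\<close>), where \<open>\<Phi>1\<close> and \<open>\<Phi>2\<close> are the Laplace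
transforms of the two exit positions.  The value \<open>q(\<sigma>)\<close> is unchanged by \<open>\<sigma> \<mapsto> 2 - \<sigma>\<close>, and
\<open>p(\<sigma>)\<close> is unchanged by \<open>\<sigma> \<mapsto> - \<sigma>\<close>.  Alternating the two reflections from \<open>s\<close> gives
\<open>\<Phi>1(q(s)) = E(2 - s) - \<Phi>2(p(2 - s)) = E(2 - s) - E(s - 2) + \<Phi>1(q(s - 2)) = \<dots>\<close>;
the orbit \<open>2 - s, s - 2, 4 - s, \<dots>\<close> is the sequence \<open>(p\<^sub>n, q\<^sub>n)\<close> for \<open>n \<le> -1\<close>, and the remainder tends
to 0 because \<open>E\<close> decays like a Gaussian along it (lemma \<open>exit_transform1_alternating_sum\<close>).

The formula that continues \<open>L1\<close> to \<open>q(s) \<ge> 0\<close> is this balance at \<open>\<sigma> = 2 - s\<close>, so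
\<open>L1(q(s)) = \<Phi>1(q(s))\<close> whatever the sign of \<open>q(s)\<close> (lemma \<open>L1_eq_exit_transform1\<close>).  Stopping
the martingale with parameter \<open>s - \<gamma>\<close> at \<open>T1\<close> on the event \<open>T1 < T2\<close>, \<open>T1 \<le> t\<close> and letting
\<open>t\<close> grow identifies \<open>\<Phi>1(q(s))\<close> with \<open>E(s)\<close> times the probability of \<open>T1 < T2\<close> under the h-transform
(lemma \<open>exit_transform1_doob\<close>).  Everything about \<open>L2\<close> follows from the reflection that replaces
\<open>W\<close> by \<open>-W\<close>, \<open>\<gamma>\<close> by \<open>1 - \<gamma>\<close>, \<open>\<alpha>\<close> by \<open>\<pi>/2 - \<alpha>\<close>, \<open>n\<close> by \<open>-n\<close> and exchanges the two axes.\<close>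

section \<open>The exponential martingale\<close>

lemma (in prob_space) indep_var_nn_integral_mult:
  fixes f g :: "_ \<Rightarrow> ennreal"
  assumes ind: "indep_var S X T Y" and f: "f \<in> borel_measurable S" and g: "g \<in> borel_measurable T"
  shows "(\<integral>\<^sup>+\<omega>. f (X \<omega>) * g (Y \<omega>) \<partial>M) = (\<integral>\<^sup>+\<omega>. f (X \<omega>) \<partial>M) * (\<integral>\<^sup>+\<omega>. g (Y \<omega>) \<partial>M)"
proof -
  have "indep_var borel (f \<circ> X) borel (g \<circ> Y)"
    by (rule indep_var_compose[OF ind f g])
  then have "indep_vars (\<lambda>_. borel) (case_bool (f \<circ> X) (g \<circ> Y)) UNIV"
    unfolding indep_var_def by (rule indep_vars_cong[THEN iffD1, rotated -1]) (auto split: bool.split)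
  from indep_vars_nn_integral[OF _ this] show ?thesis
    by (simp add: UNIV_bool mult.commute comp_def)
qed

locale brownian = prob_space M for M :: "'a measure" +
  fixes W :: "real \<Rightarrow> 'a \<Rightarrow> real"
  assumes brownian: "brownian_motion M W"
begin

abbreviation past :: "real \<Rightarrow> 'a set set" where
  "past u \<equiv> generated_sets (space M) W {0..u}"

text \<open>The density of \<open>W\<close> with drift \<open>\<theta>\<close> with respect to \<open>W\<close>, on the past up to time \<open>t\<close>.\<close>

definition wald :: "real \<Rightarrow> real \<Rightarrow> 'a \<Rightarrow> real" where
  "wald \<theta> t \<omega> = exp (\<theta> * W t \<omega> - \<theta>\<^sup>2 * t / 2)"

lemma measurable_W [measurable (raw)]: "0 \<le> t \<Longrightarrow> W t \<in> borel_measurable M"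
  using brownian by (simp add: brownian_motion_def)

lemma W_0: "\<omega> \<in> space M \<Longrightarrow> W 0 \<omega> = 0"
  using brownian by (simp add: brownian_motion_def)

lemma continuous_W: "\<omega> \<in> space M \<Longrightarrow> continuous_on {0..} (\<lambda>t. W t \<omega>)"
  using brownian by (simp add: brownian_motion_def)

lemma measurable_wald [measurable (raw)]: "0 \<le> t \<Longrightarrow> wald \<theta> t \<in> borel_measurable M"
  unfolding wald_def by measurable

lemma wald_pos: "0 < wald \<theta> t \<omega>"
  by (simp add: wald_def)

lemma past_sigma_algebra: "sigma_algebra (space M) (past u)"
  unfolding generated_sets_def by (intro sigma_algebra_sigma_sets) auto

lemma past_mono: "u \<le> v \<Longrightarrow> past u \<subseteq> past v"
  unfolding generated_sets_def by (intro sigma_sets_mono') force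

lemma past_subset_sets: "past u \<subseteq> sets M"
  unfolding generated_sets_def
  by (intro sets.sigma_sets_subset) (auto intro: measurable_sets[OF measurable_W])

lemma nn_integral_wald_increment:
  assumes "0 \<le> s" "s < t"
  shows "(\<integral>\<^sup>+\<omega>. ennreal (exp (\<theta> * (W t \<omega> - W s \<omega>) - \<theta>\<^sup>2 * (t - s) / 2)) \<partial>M) = 1"
proof -
  let ?\<sigma> = "sqrt (t - s)"
  have D: "distributed M lborel (\<lambda>\<omega>. W t \<omega> - W s \<omega>) (normal_density 0 ?\<sigma>)"
    using brownian assms by (simp add: brownian_motion_def)
  \<comment> \<open>Completing the square shifts the mean of the Gaussian density.\<close>
  have shift: "normal_density 0 ?\<sigma> x * exp (\<theta> * x - \<theta>\<^sup>2 * (t - s) / 2)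
      = normal_density (\<theta> * (t - s)) ?\<sigma> x" for x
    using assms by (simp add: normal_density_def field_simps power2_eq_square flip: exp_add)
  have "(\<integral>\<^sup>+\<omega>. ennreal (exp (\<theta> * (W t \<omega> - W s \<omega>) - \<theta>\<^sup>2 * (t - s) / 2)) \<partial>M)
      = (\<integral>\<^sup>+x. normal_density 0 ?\<sigma> x * ennreal (exp (\<theta> * x - \<theta>\<^sup>2 * (t - s) / 2)) \<partial>lborel)"
    by (rule distributed_nn_integral[OF D, symmetric]) measurable
  also have "\<dots> = (\<integral>\<^sup>+x. normal_density (\<theta> * (t - s)) ?\<sigma> x \<partial>lborel)"
    by (simp add: shift flip: ennreal_mult')
  also have "\<dots> = 1"
    using assms by (simp add: nn_integral_eq_integral normal_density_nonneg)
  finally show ?thesis .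
qed

lemma nn_integral_wald:
  assumes "0 \<le> t" shows "(\<integral>\<^sup>+\<omega>. wald \<theta> t \<omega> \<partial>M) = 1"
proof (cases "t = 0")
  case True
  then have "(\<integral>\<^sup>+\<omega>. wald \<theta> t \<omega> \<partial>M) = (\<integral>\<^sup>+\<omega>. 1 \<partial>M)"
    by (intro nn_integral_cong) (simp add: wald_def W_0)
  then show ?thesis by (simp add: emeasure_space_1)
next
  case False
  then have "(\<integral>\<^sup>+\<omega>. wald \<theta> t \<omega> \<partial>M) =
      (\<integral>\<^sup>+\<omega>. ennreal (exp (\<theta> * (W t \<omega> - W 0 \<omega>) - \<theta>\<^sup>2 * (t - 0) / 2)) \<partial>M)"
    by (intro nn_integral_cong) (simp add: wald_def W_0)
  with False assms show ?thesis by (simp only: nn_integral_wald_increment)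
qed

text \<open>The increments of \<open>W\<close> over a partition of \<open>[0, u]\<close> that contains all the times in \<open>J\<close> determine both
the event and \<open>wald \<theta> u\<close>, while the remaining factor of \<open>wald \<theta> t\<close> depends only on the independent
increment over \<open>[u, t]\<close> and has mean 1.\<close>

lemma martingale_wald_cylinder:
  assumes "0 \<le> u" "u < t" and J: "finite J" "J \<subseteq> {0..u}" and B: "\<And>s. s \<in> J \<Longrightarrow> B s \<in> sets borel"
  shows "(\<integral>\<^sup>+\<omega>\<in>{\<omega>\<in>space M. \<forall>s\<in>J. W s \<omega> \<in> B s}. ennreal (wald \<theta> t \<omega>) \<partial>M)
       = (\<integral>\<^sup>+\<omega>\<in>{\<omega>\<in>space M. \<forall>s\<in>J. W s \<omega> \<in> B s}. ennreal (wald \<theta> u \<omega>) \<partial>M)"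
proof -
  let ?C = "{\<omega>\<in>space M. \<forall>s\<in>J. W s \<omega> \<in> B s}"
  \<comment> \<open>The partition starts at 0 so that \<open>W\<close> itself, and not only its differences, is a sum of
    increments; its last point, of index \<open>m\<close>, is \<open>u\<close>.\<close>
  define L where "L = 0 # sorted_list_of_set (insert u J - {0})"
  define m where "m = length L - 1"
  define \<tau> where "\<tau> i = (if i \<le> m then L ! i else t)" for i
  define D where "D i \<omega> = W (\<tau> (Suc i)) \<omega> - W (\<tau> i) \<omega>" for i \<omega>
  have setL: "set L = insert 0 (insert u J)" and len: "length L = Suc m"
    using J by (auto simp: L_def m_def)
  have srt: "sorted_wrt (<) L"
    using J assms by (auto simp: L_def)
  have L_le: "L ! i \<le> u" if "i \<le> m" for i
    using that J assms nth_mem[of i L] by (auto simp: len setL)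
  have \<tau>0: "\<tau> 0 = 0" by (simp add: \<tau>_def L_def)
  have \<tau>_less: "\<tau> i < \<tau> (Suc i)" if "i < Suc m" for i
    using that L_le[of i] \<open>u < t\<close> sorted_wrt_nth_less[OF srt, of i "Suc i"] by (auto simp: \<tau>_def len)
  have ind: "indep_vars (\<lambda>_. borel) D {..<Suc m}"
  proof -
    have "\<forall>(\<tau> :: nat \<Rightarrow> real) n. 0 \<le> \<tau> 0 \<longrightarrow> (\<forall>i<n. \<tau> i < \<tau> (Suc i)) \<longrightarrow>
        indep_vars (\<lambda>_. borel) (\<lambda>i \<omega>. W (\<tau> (Suc i)) \<omega> - W (\<tau> i) \<omega>) {..<n}"
      using brownian unfolding brownian_motion_def by (elim conjE)
    from this[rule_format, of \<tau> "Suc m"] show ?thesis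
      using \<tau>0 \<tau>_less by (simp add: D_def[abs_def])
  qed
  have "\<forall>s\<in>set L. \<exists>j. j \<le> m \<and> L ! j = s"
    by (auto simp: in_set_conv_nth len less_Suc_eq_le)
  from bchoice[OF this] obtain k where k: "\<And>s. s \<in> set L \<Longrightarrow> k s \<le> m \<and> L ! k s = s"
    by blast
  have \<tau>m: "\<tau> m = u"
  proof -
    have "u \<le> L ! m"
      using k[of u] sorted_wrt_nth_less[OF srt, of "k u" m] by (cases "k u = m") (auto simp: setL len)
    then show ?thesis using L_le[of m] by (simp add: \<tau>_def)
  qed
  have W_sum: "W (\<tau> j) \<omega> = (\<Sum>i<j. D i \<omega>)" if "\<omega> \<in> space M" for \<omega> j
    using that sum_lessThan_telescope[of "\<lambda>i. W (\<tau> i) \<omega>" j] by (simp add: D_def \<tau>0 W_0)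
  define S where "S = PiM {..<m} (\<lambda>_::nat. borel :: real measure)"
  define f :: "(nat \<Rightarrow> real) \<Rightarrow> ennreal" where
    "f x = ennreal (exp (\<theta> * (\<Sum>i<m. x i) - \<theta>\<^sup>2 * u / 2)) * indicator {x\<in>space S. \<forall>s\<in>J. (\<Sum>i<k s. x i) \<in> B s} x" for x
  define g :: "(nat \<Rightarrow> real) \<Rightarrow> ennreal" where
    "g x = ennreal (exp (\<theta> * x m - \<theta>\<^sup>2 * (t - u) / 2))" for x
  have msum: "(\<lambda>x. \<Sum>i<j. x i) \<in> borel_measurable S" if "j \<le> m" for j
    unfolding S_def using that by (intro borel_measurable_sum measurable_component_singleton) auto
  have kJ: "k s \<le> m" if "s \<in> J" for s using k[of s] that by (simp add: setL)
  have "{x\<in>space S. \<forall>s\<in>J. (\<Sum>i<k s. x i) \<in> B s} \<in> sets S"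
    using J B kJ by (intro sets.sets_Collect_finite_All measurable_sets_Collect[OF msum]) auto
  with msum[of m] have f: "f \<in> borel_measurable S"
    unfolding f_def by measurable
  have g: "g \<in> borel_measurable (PiM {m} (\<lambda>_. borel))"
    unfolding g_def by measurable
  have iv: "indep_var S (\<lambda>\<omega>. restrict (\<lambda>i. D i \<omega>) {..<m}) (PiM {m} (\<lambda>_. borel)) (\<lambda>\<omega>. restrict (\<lambda>i. D i \<omega>) {m})"
    unfolding S_def by (rule indep_var_restrict[OF ind]) auto
  have F: "f (restrict (\<lambda>i. D i \<omega>) {..<m}) = ennreal (wald \<theta> u \<omega>) * indicator ?C \<omega>" if "\<omega> \<in> space M" for \<omega>
  proof -
    have "(\<Sum>i<k s. restrict (\<lambda>i. D i \<omega>) {..<m} i) = W s \<omega>" if "s \<in> J" for s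
    proof -
      have "(\<Sum>i<k s. restrict (\<lambda>i. D i \<omega>) {..<m} i) = (\<Sum>i<k s. D i \<omega>)"
        using kJ[OF that] by (intro sum.cong) auto
      then show ?thesis
        using W_sum[OF \<open>\<omega> \<in> space M\<close>, of "k s"] k[of s] that by (simp add: \<tau>_def setL)
    qed
    moreover have "(\<Sum>i<m. restrict (\<lambda>i. D i \<omega>) {..<m} i) = W u \<omega>"
      using W_sum[OF that, of m] \<tau>m by simp
    moreover have "restrict (\<lambda>i. D i \<omega>) {..<m} \<in> space S"
      by (simp add: S_def space_PiM)
    ultimately show ?thesis
      using that by (simp add: f_def wald_def indicator_def)
  qed
  have Dm: "D m \<omega> = W t \<omega> - W u \<omega>" for \<omega>
    using \<tau>m by (simp add: D_def) (simp add: \<tau>_def)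
  have G: "g (restrict (\<lambda>i. D i \<omega>) {m}) = ennreal (exp (\<theta> * (W t \<omega> - W u \<omega>) - \<theta>\<^sup>2 * (t - u) / 2))" for \<omega>
    by (simp add: g_def Dm)
  have "(\<integral>\<^sup>+\<omega>\<in>?C. ennreal (wald \<theta> t \<omega>) \<partial>M)
      = (\<integral>\<^sup>+\<omega>. f (restrict (\<lambda>i. D i \<omega>) {..<m}) * g (restrict (\<lambda>i. D i \<omega>) {m}) \<partial>M)"
  proof (intro nn_integral_cong)
    fix \<omega> assume w: "\<omega> \<in> space M"
    have "wald \<theta> t \<omega> = wald \<theta> u \<omega> * exp (\<theta> * (W t \<omega> - W u \<omega>) - \<theta>\<^sup>2 * (t - u) / 2)"
      by (simp add: wald_def field_simps flip: exp_add)
    then show "ennreal (wald \<theta> t \<omega>) * indicator ?C \<omega> = f (restrict (\<lambda>i. D i \<omega>) {..<m}) * g (restrict (\<lambda>i. D i \<omega>) {m})"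
      by (simp add: F[OF w] G ennreal_mult' wald_pos less_imp_le mult_ac)
  qed
  also have "\<dots> = (\<integral>\<^sup>+\<omega>. f (restrict (\<lambda>i. D i \<omega>) {..<m}) \<partial>M) * (\<integral>\<^sup>+\<omega>. g (restrict (\<lambda>i. D i \<omega>) {m}) \<partial>M)"
    by (rule indep_var_nn_integral_mult[OF iv f g])
  also have "(\<integral>\<^sup>+\<omega>. g (restrict (\<lambda>i. D i \<omega>) {m}) \<partial>M) = 1"
    unfolding G by (rule nn_integral_wald_increment) fact+
  also have "(\<integral>\<^sup>+\<omega>. f (restrict (\<lambda>i. D i \<omega>) {..<m}) \<partial>M) = (\<integral>\<^sup>+\<omega>\<in>?C. ennreal (wald \<theta> u \<omega>) \<partial>M)"
    by (intro nn_integral_cong F)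
  finally show ?thesis by simp
qed

text \<open>Both sides are finite measures of the same total mass, as functions of the event, and cylinder events
are an intersection-stable generator of the past; so agreement on cylinders extends to the whole past.\<close>

lemma martingale_wald:
  assumes "0 \<le> u" "u \<le> t" and A: "A \<in> past u"
  shows "(\<integral>\<^sup>+\<omega>\<in>A. ennreal (wald \<theta> t \<omega>) \<partial>M) = (\<integral>\<^sup>+\<omega>\<in>A. ennreal (wald \<theta> u \<omega>) \<partial>M)"
proof (cases "u = t")
  case False
  with assms have "u < t" "0 \<le> t" by auto
  define cyl where "cyl J B = {\<omega>\<in>space M. \<forall>s\<in>J. W s \<omega> \<in> B s}" for J :: "real set" and B :: "real \<Rightarrow> real set"
  define G where "G = {cyl J B | J B. finite J \<and> J \<subseteq> {0..u} \<and> (\<forall>s\<in>J. B s \<in> sets borel)}"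
  have "past u \<subseteq> sigma_sets (space M) G"
    unfolding generated_sets_def
  proof (intro sigma_sets_mono subsetI sigma_sets.Basic)
    fix A assume "A \<in> {W s -` B \<inter> space M |s B. s \<in> {0..u} \<and> B \<in> sets borel}"
    then obtain s B where "A = W s -` B \<inter> space M" "s \<in> {0..u}" "B \<in> sets borel" by auto
    then have "A = cyl {s} (\<lambda>_. B)" "s \<in> {0..u}" "B \<in> sets borel" by (auto simp: cyl_def)
    then show "A \<in> G" unfolding G_def by blast
  qed
  with A have AG: "A \<in> sigma_sets (space M) G" by blast
  have "Int_stable G"
  proof (rule Int_stableI)
    fix a b assume "a \<in> G" "b \<in> G"
    then obtain J1 B1 J2 B2 where
      *: "a = cyl J1 B1" "finite J1" "J1 \<subseteq> {0..u}" "\<forall>s\<in>J1. B1 s \<in> sets borel"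
         "b = cyl J2 B2" "finite J2" "J2 \<subseteq> {0..u}" "\<forall>s\<in>J2. B2 s \<in> sets borel"
      unfolding G_def by blast
    define B where "B s = (if s \<in> J1 then B1 s else UNIV) \<inter> (if s \<in> J2 then B2 s else UNIV)" for s
    have "a \<inter> b = cyl (J1 \<union> J2) B"
      unfolding * cyl_def B_def by (auto split: if_splits)
    moreover have "finite (J1 \<union> J2) \<and> J1 \<union> J2 \<subseteq> {0..u} \<and> (\<forall>s\<in>J1 \<union> J2. B s \<in> sets borel)"
      using * by (auto simp: B_def)
    ultimately show "a \<inter> b \<in> G" unfolding G_def by blast
  qed
  let ?N = "\<lambda>t. density M (\<lambda>\<omega>. ennreal (wald \<theta> t \<omega>))"
  have N: "emeasure (?N v) C = (\<integral>\<^sup>+\<omega>\<in>C. ennreal (wald \<theta> v \<omega>) \<partial>M)" if "0 \<le> v" "C \<in> sets M" for v C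
    using that by (intro emeasure_density) measurable
  have N1: "emeasure (?N v) (space M) = 1" if "0 \<le> v" for v
    using that nn_integral_wald[OF that, of \<theta>] by (subst N) (auto cong: nn_integral_cong_simp)
  have G_sets: "G \<subseteq> sets M"
  proof
    fix C assume "C \<in> G"
    then obtain J B where C: "C = cyl J B" "finite J" "J \<subseteq> {0..u}" "\<forall>s\<in>J. B s \<in> sets borel"
      unfolding G_def by blast
    then show "C \<in> sets M"
      unfolding C(1) cyl_def
      by (intro sets.sets_Collect_finite_All measurable_sets_Collect[OF measurable_W]) auto
  qed
  then have sG: "C \<in> sets M" if "C \<in> sigma_sets (space M) G" for C
    using that sets.sigma_sets_subset by blast
  have GP: "G \<subseteq> Pow (space M)"
    using G_sets sets.sets_into_space by blast
  have "emeasure (?N t) A = emeasure (?N u) A"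
    using \<open>Int_stable G\<close> GP AG
  proof (induction A rule: sigma_sets_induct_disjoint)
    case (basic A)
    then obtain J B where "A = cyl J B" "finite J" "J \<subseteq> {0..u}" "\<And>s. s\<in>J \<Longrightarrow> B s \<in> sets borel"
      unfolding G_def by blast
    moreover have "A \<in> sets M" using basic G_sets by blast
    ultimately show ?case
      using martingale_wald_cylinder[OF \<open>0 \<le> u\<close> \<open>u < t\<close>, of J B \<theta>] \<open>0 \<le> u\<close> \<open>0 \<le> t\<close>
      by (simp add: N cyl_def)
  next
    case (compl A)
    have c: "emeasure (?N v) (space M - A) = 1 - emeasure (?N v) A" if "0 \<le> v" for v
    proof -
      have "A \<in> sets (?N v)" using sG[OF compl(1)] by simp
      moreover have "emeasure (?N v) A \<le> emeasure (?N v) (space M)"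
        using sets.sets_into_space[OF sG[OF compl(1)]] by (intro emeasure_mono) auto
      then have "emeasure (?N v) A \<noteq> \<infinity>" using N1[OF that] by (auto simp: top_unique)
      ultimately have "emeasure (?N v) (space (?N v) - A) = emeasure (?N v) (space (?N v)) - emeasure (?N v) A"
        by (intro emeasure_compl)
      then show ?thesis using N1[OF that] by simp
    qed
    show ?case using \<open>0 \<le> u\<close> \<open>0 \<le> t\<close> compl(2) by (simp add: c)
  next
    case (union A)
    then have "range A \<subseteq> sets M" using sG by blast
    then have "emeasure (?N v) (\<Union>i. A i) = (\<Sum>i. emeasure (?N v) (A i))" for v
      using union(1) by (intro suminf_emeasure[symmetric]) auto
    then show ?case using union by simp
  qed simp
  then show ?thesis using sG[OF AG] \<open>0 \<le> u\<close> \<open>0 \<le> t\<close> by (simp add: N)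
qed simp

end

section \<open>Optional stopping\<close>

text \<open>A bound in \<open>L\<^sup>2\<close> makes the sequence uniformly integrable, so no mass can escape to infinite values in
the limit.  Fatou's lemma gives one inequality; for the other, truncate at a height \<open>K\<close> and bound what is
cut off by \<open>C / K\<close>.\<close>

lemma (in finite_measure) nn_integral_limit_of_L2_bounded:
  fixes f :: "nat \<Rightarrow> 'a \<Rightarrow> real"
  assumes [measurable]: "\<And>n. f n \<in> borel_measurable M" "g \<in> borel_measurable M"
    and nonneg: "\<And>n \<omega>. 0 \<le> f n \<omega>"
    and lim: "\<And>\<omega>. \<omega> \<in> space M \<Longrightarrow> (\<lambda>n. f n \<omega>) \<longlonglongrightarrow> g \<omega>"
    and c: "\<And>n. (\<integral>\<^sup>+\<omega>. f n \<omega> \<partial>M) = c"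
    and C: "\<And>n. (\<integral>\<^sup>+\<omega>. (f n \<omega>)\<^sup>2 \<partial>M) \<le> ennreal C" "0 \<le> C"
  shows "(\<integral>\<^sup>+\<omega>. g \<omega> \<partial>M) = c"
proof (rule antisym)
  have "(\<integral>\<^sup>+\<omega>. g \<omega> \<partial>M) = (\<integral>\<^sup>+\<omega>. liminf (\<lambda>n. ennreal (f n \<omega>)) \<partial>M)"
    by (intro nn_integral_cong lim_imp_Liminf[symmetric] tendsto_ennrealI lim) auto
  also have "\<dots> \<le> liminf (\<lambda>n. \<integral>\<^sup>+\<omega>. f n \<omega> \<partial>M)"
    by (rule nn_integral_liminf) measurable
  also have "\<dots> = c" by (simp add: c Liminf_const)
  finally show "(\<integral>\<^sup>+\<omega>. g \<omega> \<partial>M) \<le> c" .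
next
  show "c \<le> (\<integral>\<^sup>+\<omega>. g \<omega> \<partial>M)"
  proof (rule ennreal_le_epsilon)
    fix e :: real assume "0 < e"
    \<comment> \<open>\<open>K\<close> is chosen as \<open>(C + 1) / e\<close> rather than \<open>C / e\<close> to keep it positive when \<open>C = 0\<close>.\<close>
    define K where "K = (C + 1) / e"
    have K: "0 < K" using \<open>0 < e\<close> C(2) by (simp add: K_def)
    have CK: "C / K \<le> e" using \<open>0 < e\<close> C(2) by (simp add: K_def field_simps)
    have le: "c \<le> (\<integral>\<^sup>+\<omega>. min (f n \<omega>) K \<partial>M) + ennreal e" for n
    proof -
      have "f n \<omega> \<le> min (f n \<omega>) K + (f n \<omega>)\<^sup>2 / K" for \<omega>
      proof (cases "f n \<omega> \<le> K")
        case False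
        then have "K * f n \<omega> \<le> f n \<omega> * f n \<omega>" using K by (intro mult_right_mono) auto
        then have "f n \<omega> \<le> (f n \<omega>)\<^sup>2 / K" using K by (simp add: field_simps power2_eq_square)
        with False K show ?thesis by simp
      qed (use K in simp)
      moreover have "ennreal (min (f n \<omega>) K) + ennreal (1 / K) * ennreal ((f n \<omega>)\<^sup>2)
          = ennreal (min (f n \<omega>) K + (f n \<omega>)\<^sup>2 / K)" for \<omega>
        using K nonneg[of n \<omega>] by (simp flip: ennreal_plus ennreal_mult)
      ultimately have "c \<le> (\<integral>\<^sup>+\<omega>. ennreal (min (f n \<omega>) K) + ennreal (1 / K) * ennreal ((f n \<omega>)\<^sup>2) \<partial>M)"
        unfolding c[of n, symmetric] by (intro nn_integral_mono) (simp add: ennreal_leI)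
      also have "\<dots> = (\<integral>\<^sup>+\<omega>. min (f n \<omega>) K \<partial>M) + ennreal (1 / K) * (\<integral>\<^sup>+\<omega>. (f n \<omega>)\<^sup>2 \<partial>M)"
        by (simp add: nn_integral_add nn_integral_cmult)
      also have "\<dots> \<le> (\<integral>\<^sup>+\<omega>. min (f n \<omega>) K \<partial>M) + ennreal (1 / K) * ennreal C"
        by (intro add_left_mono mult_left_mono C) simp
      also have "ennreal (1 / K) * ennreal C = ennreal (C / K)"
        using K C(2) by (simp flip: ennreal_mult)
      also have "(\<integral>\<^sup>+\<omega>. min (f n \<omega>) K \<partial>M) + ennreal (C / K) \<le> (\<integral>\<^sup>+\<omega>. min (f n \<omega>) K \<partial>M) + ennreal e"
        using CK by (intro add_left_mono ennreal_leI)
      finally show ?thesis .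
    qed
    have "(\<lambda>n. \<integral>\<^sup>+\<omega>. min (f n \<omega>) K \<partial>M) \<longlonglongrightarrow> (\<integral>\<^sup>+\<omega>. min (g \<omega>) K \<partial>M)"
    proof (rule nn_integral_dominated_convergence)
      show "(\<integral>\<^sup>+\<omega>. ennreal K \<partial>M) < \<infinity>"
        by (simp add: ennreal_mult_less_top emeasure_eq_measure)
      show "AE \<omega> in M. (\<lambda>n. ennreal (min (f n \<omega>) K)) \<longlonglongrightarrow> ennreal (min (g \<omega>) K)"
        by (intro AE_I2 tendsto_ennrealI tendsto_min lim tendsto_const)
      show "AE \<omega> in M. ennreal (min (f n \<omega>) K) \<le> ennreal K" for n
        by (intro AE_I2 ennreal_leI) simp
    qed auto
    then have "(\<lambda>n. (\<integral>\<^sup>+\<omega>. min (f n \<omega>) K \<partial>M) + ennreal e) \<longlonglongrightarrow> (\<integral>\<^sup>+\<omega>. min (g \<omega>) K \<partial>M) + ennreal e"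
      by (intro tendsto_add tendsto_const)
    from LIMSEQ_le_const[OF this] have "c \<le> (\<integral>\<^sup>+\<omega>. min (g \<omega>) K \<partial>M) + ennreal e"
      using le by blast
    also have "\<dots> \<le> (\<integral>\<^sup>+\<omega>. g \<omega> \<partial>M) + ennreal e"
      by (intro add_right_mono nn_integral_mono ennreal_leI) simp
    finally show "c \<le> (\<integral>\<^sup>+\<omega>. g \<omega> \<partial>M) + ennreal e" .
  qed
qed

context brownian
begin

text \<open>The stopping time \<open>\<tau>\<close> is only required on an event \<open>A\<close>, where it is bounded by \<open>t\<close>; the event may be
one that is decided at time \<open>\<tau>\<close>, such as exit through a given side.  Rounding \<open>\<tau>\<close> up to a grid gives a
stopping time with finitely many values, for which the identity is a finite sum of martingale identities.
As the grid is refined the rounded times converge to \<open>\<tau>\<close>, and path continuity together with uniform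
integrability carries the identity to the limit.\<close>

lemma optional_stopping_wald:
  assumes t: "0 < t" and \<tau>: "\<And>\<omega>. \<omega> \<in> A \<Longrightarrow> 0 \<le> \<tau> \<omega> \<and> \<tau> \<omega> \<le> t"
    and past: "\<And>u. 0 \<le> u \<Longrightarrow> u \<le> t \<Longrightarrow> {\<omega>\<in>A. \<tau> \<omega> \<le> u} \<in> past u"
  shows "(\<integral>\<^sup>+\<omega>\<in>A. ennreal (wald \<theta> t \<omega>) \<partial>M) = (\<integral>\<^sup>+\<omega>\<in>A. ennreal (wald \<theta> (\<tau> \<omega>) \<omega>) \<partial>M)"
proof -
  \<comment> \<open>The rounded time is \<open>v n (k n \<omega>)\<close>, the first point not before \<open>\<tau>\<close> of the grid of mesh \<open>t / Suc n\<close>.\<close>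
  define k where "k n \<omega> = nat \<lceil>\<tau> \<omega> * Suc n / t\<rceil>" for n \<omega>
  define v where "v n j = t * real j / Suc n" for n j :: nat
  have k_le: "k n \<omega> \<le> j \<longleftrightarrow> \<tau> \<omega> \<le> v n j" if "\<omega> \<in> A" for n j \<omega>
    using t by (simp add: k_def v_def nat_le_iff ceiling_le_iff pos_divide_le_eq pos_le_divide_eq mult.commute)
  have v_t: "v n j \<le> t \<longleftrightarrow> j \<le> Suc n" and v_nonneg: "0 \<le> v n j" for n j
    using t by (simp_all add: v_def pos_divide_le_eq del: of_nat_Suc)
  have kn: "k n \<omega> \<le> Suc n" if "\<omega> \<in> A" for n \<omega>
    using \<tau>[OF that] k_le[OF that, of n "Suc n"] t by (simp add: v_def del: of_nat_Suc)
  have Ak: "{\<omega>\<in>A. k n \<omega> = j} \<in> past (v n j)" if "j \<le> Suc n" for n j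
  proof -
    interpret P: sigma_algebra "space M" "past (v n j)" by (rule past_sigma_algebra)
    have le: "{\<omega>\<in>A. k n \<omega> \<le> i} \<in> past (v n j)" if "i \<le> j" for i
    proof -
      have "{\<omega>\<in>A. k n \<omega> \<le> i} = {\<omega>\<in>A. \<tau> \<omega> \<le> v n i}" using k_le by auto
      moreover have "v n i \<le> v n j" using that t by (simp add: v_def divide_right_mono)
      moreover have "{\<omega>\<in>A. \<tau> \<omega> \<le> v n i} \<in> past (v n i)"
        using that \<open>j \<le> Suc n\<close> by (intro past v_nonneg) (simp add: v_t)
      ultimately show ?thesis
        using past_mono[of "v n i" "v n j"] by auto
    qed
    show ?thesis
    proof (cases j)
      case 0
      with le[of 0] show ?thesis by simp
    next
      case (Suc i)
      then have "{\<omega>\<in>A. k n \<omega> = j} = {\<omega>\<in>A. k n \<omega> \<le> j} - {\<omega>\<in>A. k n \<omega> \<le> i}" by auto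
      then show ?thesis using P.Diff[OF le[of j] le[of i]] Suc by simp
    qed
  qed
  have AkM: "{\<omega>\<in>A. k n \<omega> = j} \<in> sets M" if "j \<le> Suc n" for n j
    using past_subset_sets Ak[OF that] by blast
  have meas_term: "(\<lambda>\<omega>. ennreal (wald \<theta> s \<omega>) * indicator {\<omega>\<in>A. k n \<omega> = j} \<omega>) \<in> borel_measurable M"
    if "0 \<le> s" "j \<le> Suc n" for \<theta> s n j
    using AkM[OF that(2)] measurable_wald[OF that(1)] by measurable
  define f where "f \<theta> n \<omega> = wald \<theta> (v n (k n \<omega>)) \<omega> * indicator A \<omega>" for \<theta> n \<omega>
  have split: "h (k n \<omega>) * indicator A \<omega> = (\<Sum>j\<le>Suc n. h j * indicator {\<omega>\<in>A. k n \<omega> = j} \<omega>)"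
    for h :: "nat \<Rightarrow> ennreal" and n \<omega>
  proof (cases "\<omega> \<in> A")
    case True
    then have "(\<Sum>j\<le>Suc n. h j * indicator {\<omega>\<in>A. k n \<omega> = j} \<omega>) = (\<Sum>j\<le>Suc n. if k n \<omega> = j then h j else 0)"
      by (intro sum.cong) (auto simp: indicator_def)
    with True kn[OF True, of n] show ?thesis by (simp del: sum.atMost_Suc)
  qed (simp add: indicator_def)
  have f_enn: "ennreal (f \<theta> n \<omega>) = (\<Sum>j\<le>Suc n. ennreal (wald \<theta> (v n j) \<omega>) * indicator {\<omega>\<in>A. k n \<omega> = j} \<omega>)" for \<theta> n \<omega>
    unfolding f_def by (subst split[symmetric]) (simp add: indicator_def)
  have f_meas [measurable]: "f \<theta> n \<in> borel_measurable M" for \<theta> n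
  proof -
    have "(\<lambda>\<omega>. ennreal (f \<theta> n \<omega>)) \<in> borel_measurable M"
      unfolding f_enn by (intro borel_measurable_sum meas_term v_nonneg) simp
    then have "(\<lambda>\<omega>. enn2real (ennreal (f \<theta> n \<omega>))) \<in> borel_measurable M" by measurable
    moreover have "0 \<le> f \<theta> n \<omega>" for \<omega> by (simp add: f_def wald_pos less_imp_le)
    ultimately show ?thesis by simp
  qed
  have int_f: "(\<integral>\<^sup>+\<omega>. ennreal (f \<theta> n \<omega>) \<partial>M) = (\<integral>\<^sup>+\<omega>\<in>A. ennreal (wald \<theta> t \<omega>) \<partial>M)" for \<theta> n
  proof -
    have "(\<integral>\<^sup>+\<omega>. ennreal (f \<theta> n \<omega>) \<partial>M) = (\<Sum>j\<le>Suc n. \<integral>\<^sup>+\<omega>\<in>{\<omega>\<in>A. k n \<omega> = j}. ennreal (wald \<theta> (v n j) \<omega>) \<partial>M)"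
      unfolding f_enn by (intro nn_integral_sum meas_term v_nonneg) simp
    also have "\<dots> = (\<Sum>j\<le>Suc n. \<integral>\<^sup>+\<omega>\<in>{\<omega>\<in>A. k n \<omega> = j}. ennreal (wald \<theta> t \<omega>) \<partial>M)"
      by (intro sum.cong refl martingale_wald[symmetric] Ak v_nonneg) (simp_all add: v_t)
    also have "\<dots> = (\<integral>\<^sup>+\<omega>. (\<Sum>j\<le>Suc n. ennreal (wald \<theta> t \<omega>) * indicator {\<omega>\<in>A. k n \<omega> = j} \<omega>) \<partial>M)"
      using t by (intro nn_integral_sum[symmetric] meas_term) auto
    also have "\<dots> = (\<integral>\<^sup>+\<omega>\<in>A. ennreal (wald \<theta> t \<omega>) \<partial>M)"
      by (intro nn_integral_cong split[symmetric])
    finally show ?thesis .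
  qed
  have lim: "(\<lambda>n. f \<theta> n \<omega>) \<longlonglongrightarrow> wald \<theta> (\<tau> \<omega>) \<omega> * indicator A \<omega>" if "\<omega> \<in> space M" for \<omega>
  proof (cases "\<omega> \<in> A")
    case True
    have "(\<lambda>n. v n (k n \<omega>)) \<longlonglongrightarrow> \<tau> \<omega>"
    proof (rule tendsto_sandwich)
      show "\<forall>\<^sub>F n in sequentially. \<tau> \<omega> \<le> v n (k n \<omega>)" using k_le[OF True, THEN iffD1, OF order_refl] by (intro always_eventually) blast
      have "v n (k n \<omega>) \<le> \<tau> \<omega> + t / Suc n" for n
      proof -
        have "0 \<le> \<tau> \<omega> * Suc n / t" using \<tau>[OF True] t by simp
        then have "real (k n \<omega>) \<le> \<tau> \<omega> * Suc n / t + 1"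
          unfolding k_def by linarith
        then show ?thesis using t by (simp add: v_def field_simps del: of_nat_Suc)
      qed
      then show "\<forall>\<^sub>F n in sequentially. v n (k n \<omega>) \<le> \<tau> \<omega> + t / Suc n" by simp
      have "(\<lambda>n. \<tau> \<omega> + t * inverse (real (Suc n))) \<longlonglongrightarrow> \<tau> \<omega> + t * 0"
        by (intro tendsto_intros LIMSEQ_inverse_real_of_nat)
      then show "(\<lambda>n. \<tau> \<omega> + t / Suc n) \<longlonglongrightarrow> \<tau> \<omega>" by (simp add: divide_inverse)
    qed simp
    moreover have "continuous_on {0..} (\<lambda>s. wald \<theta> s \<omega>)"
      unfolding wald_def by (intro continuous_intros continuous_W that) simp_all
    ultimately have "(\<lambda>n. wald \<theta> (v n (k n \<omega>)) \<omega>) \<longlonglongrightarrow> wald \<theta> (\<tau> \<omega>) \<omega>"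
      using \<tau>[OF True] v_nonneg
      by (intro continuous_on_tendsto_compose[where f = "\<lambda>s. wald \<theta> s \<omega>" and s = "{0..}"] always_eventually) simp_all
    then show ?thesis using True by (simp add: f_def)
  qed (simp add: f_def)
  have meas: "(\<lambda>\<omega>. wald \<theta> (\<tau> \<omega>) \<omega> * indicator A \<omega>) \<in> borel_measurable M"
    by (rule borel_measurable_LIMSEQ_real[OF lim f_meas])
  \<comment> \<open>The square of \<open>wald \<theta>\<close> is \<open>wald (2 * \<theta>)\<close> up to a bounded factor, so the same identity with
    \<open>2 * \<theta>\<close> bounds the second moments.\<close>
  have sq: "(f \<theta> n \<omega>)\<^sup>2 \<le> exp (\<theta>\<^sup>2 * t) * f (2 * \<theta>) n \<omega>" for n \<omega>
  proof (cases "\<omega> \<in> A")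
    case True
    let ?s = "v n (k n \<omega>)"
    have "(wald \<theta> ?s \<omega>)\<^sup>2 = exp (\<theta>\<^sup>2 * ?s) * wald (2 * \<theta>) ?s \<omega>"
      by (simp add: wald_def power2_eq_square field_simps flip: exp_add)
    also have "\<dots> \<le> exp (\<theta>\<^sup>2 * t) * wald (2 * \<theta>) ?s \<omega>"
      using kn[OF True, of n] v_t[of n "k n \<omega>"] wald_pos[of "2 * \<theta>" ?s \<omega>]
      by (intro mult_right_mono) (auto intro!: mult_left_mono)
    finally show ?thesis using True by (simp add: f_def)
  qed (simp add: f_def)
  have L2: "(\<integral>\<^sup>+\<omega>. ennreal ((f \<theta> n \<omega>)\<^sup>2) \<partial>M) \<le> ennreal (exp (\<theta>\<^sup>2 * t))" for n
  proof -
    have "(\<integral>\<^sup>+\<omega>. ennreal ((f \<theta> n \<omega>)\<^sup>2) \<partial>M) \<le> (\<integral>\<^sup>+\<omega>. ennreal (exp (\<theta>\<^sup>2 * t)) * ennreal (f (2 * \<theta>) n \<omega>) \<partial>M)"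
      using sq by (intro nn_integral_mono) (simp flip: ennreal_mult' add: ennreal_leI)
    also have "\<dots> = ennreal (exp (\<theta>\<^sup>2 * t)) * (\<integral>\<^sup>+\<omega>\<in>A. ennreal (wald (2 * \<theta>) t \<omega>) \<partial>M)"
      by (simp add: nn_integral_cmult int_f)
    also have "\<dots> \<le> ennreal (exp (\<theta>\<^sup>2 * t)) * (\<integral>\<^sup>+\<omega>. ennreal (wald (2 * \<theta>) t \<omega>) \<partial>M)"
      by (intro mult_left_mono nn_integral_mono) (auto simp: indicator_def)
    finally show ?thesis using t by (simp add: nn_integral_wald)
  qed
  have "(\<integral>\<^sup>+\<omega>. ennreal (wald \<theta> (\<tau> \<omega>) \<omega> * indicator A \<omega>) \<partial>M) = (\<integral>\<^sup>+\<omega>\<in>A. ennreal (wald \<theta> t \<omega>) \<partial>M)"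
    by (rule nn_integral_limit_of_L2_bounded[OF f_meas meas _ lim int_f L2])
      (auto simp: f_def wald_pos less_imp_le)
  moreover have "(\<integral>\<^sup>+\<omega>. ennreal (wald \<theta> (\<tau> \<omega>) \<omega> * indicator A \<omega>) \<partial>M) = (\<integral>\<^sup>+\<omega>\<in>A. ennreal (wald \<theta> (\<tau> \<omega>) \<omega>) \<partial>M)"
    by (intro nn_integral_cong) (simp add: indicator_def)
  ultimately show ?thesis by simp
qed

end

section \<open>Hitting times of lines\<close>

definition line_hit :: "(real \<Rightarrow> 'a \<Rightarrow> real) \<Rightarrow> real \<Rightarrow> real \<Rightarrow> 'a \<Rightarrow> ereal" where
  "line_hit W b m \<omega> = Inf (ereal ` {t. 0 \<le> t \<and> W t \<omega> = b + m * t})"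

lemma line_hit_nonneg: "0 \<le> line_hit W b m \<omega>"
  unfolding line_hit_def by (rule Inf_greatest) auto

text \<open>At a time \<open>t\<close> at which one coordinate of \<open>Z\<close> vanishes the other one is \<open>x + y + t\<close>, so the restriction
to the half-axis holds by itself.\<close>

lemma T1_eq_line_hit: "0 < x + y \<Longrightarrow> T1 W \<gamma> (x, y) = line_hit W x (1 - \<gamma>)"
proof
  fix \<omega> assume "0 < x + y"
  have "Z W \<gamma> (x, y) t \<omega> \<in> {0} \<times> {0..} \<longleftrightarrow> W t \<omega> = x + (1 - \<gamma>) * t" if "0 \<le> t" for t
    using that \<open>0 < x + y\<close> by (auto simp: Z_def displacement_def algebra_simps)
  then have "{t. 0 \<le> t \<and> Z W \<gamma> (x, y) t \<omega> \<in> {0} \<times> {0..}} = {t. 0 \<le> t \<and> W t \<omega> = x + (1 - \<gamma>) * t}"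
    by (simp cong: conj_cong)
  then show "T1 W \<gamma> (x, y) \<omega> = line_hit W x (1 - \<gamma>) \<omega>"
    by (simp only: T1_def line_hit_def)
qed

lemma T2_eq_line_hit: "0 < x + y \<Longrightarrow> T2 W \<gamma> (x, y) = line_hit (\<lambda>t \<omega>. - W t \<omega>) y \<gamma>"
proof
  fix \<omega> assume "0 < x + y"
  have "Z W \<gamma> (x, y) t \<omega> \<in> {0..} \<times> {0} \<longleftrightarrow> - W t \<omega> = y + \<gamma> * t" if "0 \<le> t" for t
    using that \<open>0 < x + y\<close> by (auto simp: Z_def displacement_def algebra_simps)
  then have "{t. 0 \<le> t \<and> Z W \<gamma> (x, y) t \<omega> \<in> {0..} \<times> {0}} = {t. 0 \<le> t \<and> - W t \<omega> = y + \<gamma> * t}"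
    by (simp cong: conj_cong)
  then show "T2 W \<gamma> (x, y) \<omega> = line_hit (\<lambda>t \<omega>. - W t \<omega>) y \<gamma> \<omega>"
    by (simp only: T2_def line_hit_def)
qed

context brownian
begin

lemma line_hit_attained:
  assumes "\<omega> \<in> space M" "line_hit W b m \<omega> \<noteq> \<infinity>"
  shows "\<exists>r\<ge>0. line_hit W b m \<omega> = ereal r \<and> W r \<omega> = b + m * r"
proof -
  let ?S = "{t. 0 \<le> t \<and> W t \<omega> = b + m * t}"
  have "?S = {t\<in>{0..}. W t \<omega> - m * t = b}" by auto
  moreover have "closed {t\<in>{0..}. W t \<omega> - m * t = b}"
    by (intro continuous_closed_preimage_constant continuous_intros continuous_W assms)
  ultimately have "closed ?S" by simp
  moreover have "?S \<noteq> {}"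
  proof
    assume "?S = {}"
    then have "line_hit W b m \<omega> = \<infinity>"
      unfolding line_hit_def by (simp only: image_empty Inf_empty top_ereal_def)
    with assms(2) show False ..
  qed
  moreover have "bdd_below ?S" by (intro bdd_belowI[of _ 0]) auto
  ultimately have "Inf ?S \<in> ?S" by (intro closed_contains_Inf)
  moreover have "line_hit W b m \<omega> = ereal (Inf ?S)"
    unfolding line_hit_def
    using \<open>Inf ?S \<in> ?S\<close> \<open>bdd_below ?S\<close> by (intro Inf_eqI) (auto intro!: cInf_lower)
  ultimately show ?thesis by blast
qed

lemma line_hit_le_iff:
  assumes "\<omega> \<in> space M"
  shows "line_hit W b m \<omega> \<le> ereal u \<longleftrightarrow> (\<exists>t. 0 \<le> t \<and> t \<le> u \<and> W t \<omega> = b + m * t)"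
proof
  assume "line_hit W b m \<omega> \<le> ereal u"
  then show "\<exists>t. 0 \<le> t \<and> t \<le> u \<and> W t \<omega> = b + m * t"
    using line_hit_attained[OF assms, of b m] by (cases "line_hit W b m \<omega> = \<infinity>") auto
next
  assume "\<exists>t. 0 \<le> t \<and> t \<le> u \<and> W t \<omega> = b + m * t"
  then obtain t where t: "0 \<le> t" "t \<le> u" "W t \<omega> = b + m * t" by blast
  then have "line_hit W b m \<omega> \<le> ereal t"
    unfolding line_hit_def by (intro Inf_lower) auto
  with t(2) show "line_hit W b m \<omega> \<le> ereal u" by (meson ereal_less_eq(3) order_trans)
qed

lemma line_hit_le_if_above:
  assumes "\<omega> \<in> space M" "0 < b" "0 \<le> t" "b + m * t \<le> W t \<omega>"
  shows "line_hit W b m \<omega> \<le> ereal t"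
proof -
  have "\<exists>s\<ge>0. s \<le> t \<and> W s \<omega> - m * s = b"
  proof (rule IVT')
    show "continuous_on {0..t} (\<lambda>s. W s \<omega> - m * s)"
      by (intro continuous_intros continuous_on_subset[OF continuous_W]) (use assms in auto)
  qed (use assms in \<open>auto simp: W_0\<close>)
  then show ?thesis
    by (subst line_hit_le_iff[OF assms(1)]) (auto simp: algebra_simps)
qed

text \<open>Countably many times suffice to decide whether the line has been met by time \<open>u\<close>: by continuity the path
comes within every positive distance of the line at rational times, and by compactness coming arbitrarily
close implies touching.  The end point \<open>u\<close> is among these times so that only contacts before \<open>u\<close> have to be
approximated, which is done from the right.\<close>

lemma line_hit_le_iff_countable:
  assumes w: "\<omega> \<in> space M" and "0 < b" "0 \<le> u"
  shows "line_hit W b m \<omega> \<le> ereal u \<longleftrightarrow>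
    (\<forall>n. \<exists>r\<in>insert u (\<rat> \<inter> {0..u}). b + m * r - 1 / Suc n < W r \<omega>)" (is "?L \<longleftrightarrow> ?R")
proof
  have cont: "continuous_on {0..u} (\<lambda>s. W s \<omega> - m * s)"
    by (intro continuous_intros continuous_on_subset[OF continuous_W]) (use w in auto)
  { assume ?L
    then obtain t where t: "0 \<le> t" "t \<le> u" "W t \<omega> = b + m * t"
      using line_hit_le_iff[OF w] by blast
    show ?R
    proof
      fix n
      show "\<exists>r\<in>insert u (\<rat> \<inter> {0..u}). b + m * r - 1 / Suc n < W r \<omega>"
      proof (cases "t = u")
        case True
        with t show ?thesis by (intro bexI[of _ u]) auto
      next
        case False
        then have "0 < u" using t by auto
        obtain d where d: "0 < d" "\<And>s. s \<in> {0..u} \<Longrightarrow> dist s t < d \<Longrightarrow>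
            dist (W s \<omega> - m * s) (W t \<omega> - m * t) < 1 / Suc n"
          using cont t unfolding continuous_on_iff by (metis atLeastAtMost_iff of_nat_0_less_iff zero_less_Suc zero_less_divide_1_iff)
        have "t < min u (t + d)" using False t d(1) by auto
        then obtain r where r: "r \<in> \<rat>" "t < r" "r < min u (t + d)"
          using Rats_dense_in_real by blast
        then have "dist (W r \<omega> - m * r) (W t \<omega> - m * t) < 1 / Suc n"
          using t by (intro d(2)) (auto simp: dist_real_def)
        then have "b + m * r - 1 / Suc n < W r \<omega>"
          using t(3) by (simp add: dist_real_def abs_less_iff)
        moreover have "r \<in> \<rat> \<inter> {0..u}" using r t by auto
        ultimately show ?thesis by blast
      qed
    qed }
  { assume ?R
    obtain s where s: "s \<in> {0..u}" "\<And>r. r \<in> {0..u} \<Longrightarrow> W r \<omega> - m * r \<le> W s \<omega> - m * s"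
      using continuous_attains_sup[OF _ _ cont] \<open>0 \<le> u\<close> by auto
    have "b \<le> W s \<omega> - m * s + 1 / Suc n" for n
    proof -
      obtain r where "r \<in> {0..u}" "b + m * r - 1 / Suc n < W r \<omega>"
        using \<open>?R\<close>[rule_format, of n] \<open>0 \<le> u\<close> by auto
      with s(2)[of r] show ?thesis by simp
    qed
    moreover have "(\<lambda>n. W s \<omega> - m * s + inverse (real (Suc n))) \<longlonglongrightarrow> W s \<omega> - m * s + 0"
      by (intro tendsto_intros LIMSEQ_inverse_real_of_nat)
    ultimately have "b \<le> W s \<omega> - m * s + 0"
      by (intro LIMSEQ_le_const) (auto simp: divide_inverse)
    then have "line_hit W b m \<omega> \<le> ereal s"
      using s(1) \<open>0 < b\<close> by (intro line_hit_le_if_above w) auto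
    with s(1) show ?L by (meson atLeastAtMost_iff ereal_less_eq(3) order_trans) }
qed

lemma line_hit_stopping_time:
  assumes "0 < b" "0 \<le> u"
  shows "{\<omega>\<in>space M. line_hit W b m \<omega> \<le> ereal u} \<in> past u"
proof -
  interpret P: sigma_algebra "space M" "past u" by (rule past_sigma_algebra)
  let ?D = "insert u (\<rat> \<inter> {0..u})"
  have 1: "{\<omega>\<in>space M. c < W r \<omega>} \<in> past u" if "r \<in> ?D" for c r
  proof -
    have "{\<omega>\<in>space M. c < W r \<omega>} = W r -` {c<..} \<inter> space M" by auto
    moreover have "r \<in> {0..u}" using that \<open>0 \<le> u\<close> by auto
    ultimately show ?thesis
      unfolding generated_sets_def
      by (intro sigma_sets.Basic CollectI exI[of _ r] exI[of _ "{c<..}"]) simp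
  qed
  have "countable ?D" by (intro countable_insert countable_Int1 countable_rat)
  then have "{\<omega>\<in>space M. \<forall>n::nat. \<exists>r\<in>?D. b + m * r - 1 / Suc n < W r \<omega>} \<in> past u"
    by (intro P.sets_Collect_countable_All P.sets_Collect_countable_Ex' 1)
  also have "{\<omega>\<in>space M. \<forall>n::nat. \<exists>r\<in>?D. b + m * r - 1 / Suc n < W r \<omega>} = {\<omega>\<in>space M. line_hit W b m \<omega> \<le> ereal u}"
    using line_hit_le_iff_countable[OF _ assms] by blast
  finally show ?thesis .
qed

text \<open>If \<open>S < T\<close> and \<open>S \<le> u\<close>, then the strict inequality is witnessed by a time \<open>r \<le> u\<close> with
\<open>S \<le> r < T\<close>: take \<open>u\<close> itself or a rational number between \<open>S\<close> and \<open>T\<close>.\<close>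

lemma stopping_time_comparison:
  fixes S T :: "'a \<Rightarrow> ereal"
  assumes "0 \<le> u" and nonneg: "\<And>\<omega>. 0 \<le> S \<omega>"
    and S: "\<And>v. 0 \<le> v \<Longrightarrow> {\<omega>\<in>space M. S \<omega> \<le> ereal v} \<in> past v"
    and T: "\<And>v. 0 \<le> v \<Longrightarrow> {\<omega>\<in>space M. T \<omega> \<le> ereal v} \<in> past v"
  shows "{\<omega>\<in>space M. S \<omega> < T \<omega> \<and> S \<omega> \<le> ereal u} \<in> past u"
proof -
  interpret P: sigma_algebra "space M" "past u" by (rule past_sigma_algebra)
  let ?D = "insert u (\<rat> \<inter> {0..u})"
  have D: "0 \<le> r \<and> r \<le> u" if "r \<in> ?D" for r using that \<open>0 \<le> u\<close> by auto
  have "{\<omega>\<in>space M. S \<omega> \<le> ereal r} \<in> past u" "{\<omega>\<in>space M. T \<omega> \<le> ereal r} \<in> past u" if "r \<in> ?D" for r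
    using S[of r] T[of r] D[OF that] past_mono[of r u] by auto
  then have "{\<omega>\<in>space M. \<exists>r\<in>?D. S \<omega> \<le> ereal r \<and> \<not> T \<omega> \<le> ereal r} \<in> past u"
    by (intro P.sets_Collect_countable_Ex' P.sets_Collect_conj P.sets_Collect_neg
          countable_insert countable_Int1 countable_rat)
  also have "{\<omega>\<in>space M. \<exists>r\<in>?D. S \<omega> \<le> ereal r \<and> \<not> T \<omega> \<le> ereal r} =
      {\<omega>\<in>space M. S \<omega> < T \<omega> \<and> S \<omega> \<le> ereal u}"
  proof (intro Collect_cong conj_cong refl iffI)
    fix \<omega> assume "\<exists>r\<in>?D. S \<omega> \<le> ereal r \<and> \<not> T \<omega> \<le> ereal r"
    then obtain r where r: "r \<in> ?D" "S \<omega> \<le> ereal r" "\<not> T \<omega> \<le> ereal r" by blast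
    then show "S \<omega> < T \<omega> \<and> S \<omega> \<le> ereal u"
      using D[OF r(1)] by (meson ereal_less_eq(3) not_le order_le_less_trans order_trans)
  next
    fix \<omega> assume a: "S \<omega> < T \<omega> \<and> S \<omega> \<le> ereal u"
    show "\<exists>r\<in>?D. S \<omega> \<le> ereal r \<and> \<not> T \<omega> \<le> ereal r"
    proof (cases "T \<omega> \<le> ereal u")
      case False
      with a show ?thesis by blast
    next
      case True
      then obtain s t where st: "S \<omega> = ereal s" "T \<omega> = ereal t"
        using a nonneg[of \<omega>] by (cases "S \<omega>"; cases "T \<omega>") auto
      then obtain r where "r \<in> \<rat>" "s < r" "r < t"
        using a Rats_dense_in_real by auto
      then show ?thesis using True st nonneg[of \<omega>] by (intro bexI[of _ r]) auto
    qed
  qed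
  finally show ?thesis .
qed

lemma measurable_of_stopping_time:
  fixes R :: "'a \<Rightarrow> ereal"
  assumes "\<And>u. 0 \<le> u \<Longrightarrow> {\<omega>\<in>space M. R \<omega> \<le> ereal u} \<in> past u" "\<And>\<omega>. 0 \<le> R \<omega>"
  shows "R \<in> borel_measurable M"
proof (rule borel_measurableI_le)
  fix c :: ereal
  show "{\<omega>\<in>space M. R \<omega> \<le> c} \<in> sets M"
  proof (cases "c < 0")
    case True
    then have "{\<omega>\<in>space M. R \<omega> \<le> c} = {}" using assms(2) by (auto simp: not_le intro: less_le_trans)
    then show ?thesis by (simp only: sets.empty_sets)
  next
    case False
    show ?thesis
    proof (cases c)
      case (real r)
      with False show ?thesis using subsetD[OF past_subset_sets assms(1)[of r]] by simp
    qed (use False in simp_all)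
  qed
qed

end

lemma brownian_motion_uminus:
  assumes "brownian_motion M W" shows "brownian_motion M (\<lambda>t \<omega>. - W t \<omega>)"
proof -
  interpret brownian M W using assms by (auto simp: brownian_def brownian_axioms_def brownian_motion_def)
  have "distributed M lborel (\<lambda>\<omega>. - W t \<omega> - - W s \<omega>) (normal_density 0 (sqrt (t - s)))" if "0 \<le> s" "s < t" for s t
  proof -
    have "distributed M lborel (\<lambda>\<omega>. W t \<omega> - W s \<omega>) (normal_density 0 (sqrt (t - s)))"
      using assms that by (simp add: brownian_motion_def)
    from normal_density_affine[OF this, of "-1" 0] that show ?thesis by simp
  qed
  moreover have "indep_vars (\<lambda>_. borel) (\<lambda>i \<omega>. - W (\<tau> (Suc i)) \<omega> - - W (\<tau> i) \<omega>) {..<n}"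
    if "0 \<le> \<tau> 0" "\<forall>i<n. \<tau> i < \<tau> (Suc i)" for \<tau> :: "nat \<Rightarrow> real" and n
  proof -
    have "\<forall>(\<tau> :: nat \<Rightarrow> real) n. 0 \<le> \<tau> 0 \<longrightarrow> (\<forall>i<n. \<tau> i < \<tau> (Suc i)) \<longrightarrow>
        indep_vars (\<lambda>_. borel) (\<lambda>i \<omega>. W (\<tau> (Suc i)) \<omega> - W (\<tau> i) \<omega>) {..<n}"
      using assms unfolding brownian_motion_def by (elim conjE)
    then have "indep_vars (\<lambda>_. borel) (\<lambda>i \<omega>. W (\<tau> (Suc i)) \<omega> - W (\<tau> i) \<omega>) {..<n}"
      using that by blast
    from indep_vars_compose2[OF this, of "\<lambda>_ x. - x" "\<lambda>_. borel"] show ?thesis by simp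
  qed
  ultimately show ?thesis
    using prob_space_axioms
    by (auto simp: brownian_motion_def W_0 intro!: continuous_on_minus continuous_W)
qed

lemma generated_sets_uminus:
  "generated_sets \<Omega> (\<lambda>t \<omega>. - W t \<omega> :: real) I = generated_sets \<Omega> W I"
proof -
  have "{(\<lambda>\<omega>. - W s \<omega>) -` B \<inter> \<Omega> |s B. s \<in> I \<and> B \<in> sets borel} \<subseteq> {W s -` B \<inter> \<Omega> |s B. s \<in> I \<and> B \<in> sets borel}"
    for W :: "real \<Rightarrow> 'a \<Rightarrow> real"
  proof safe
    fix s :: real and B :: "real set" assume "s \<in> I" "B \<in> sets borel"
    moreover have "(\<lambda>\<omega>. - W s \<omega>) -` B \<inter> \<Omega> = W s -` (uminus -` B) \<inter> \<Omega>" by auto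
    moreover have "uminus -` B \<in> sets borel"
      using measurable_sets[OF borel_measurable_uminus[OF measurable_ident] \<open>B \<in> sets borel\<close>] by simp
    ultimately show "\<exists>s' B'. (\<lambda>\<omega>. - W s \<omega>) -` B \<inter> \<Omega> = W s' -` B' \<inter> \<Omega> \<and> s' \<in> I \<and> B' \<in> sets borel" by blast
  qed
  from this[of W] this[of "\<lambda>t \<omega>. - W t \<omega>"] show ?thesis
    unfolding generated_sets_def by (simp add: subset_antisym)
qed

section \<open>Harmonic exponentials and the exit from the quadrant\<close>

text \<open>The reflection of the plane in the diagonal lets every fact about one axis be transferred to the other.\<close>

lemma T1_mirror: "0 < x + y \<Longrightarrow> T1 (\<lambda>t \<omega>. - W t \<omega>) (1 - \<gamma>) (y, x) = T2 W \<gamma> (x, y)"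
  by (simp add: T1_eq_line_hit T2_eq_line_hit add.commute)

lemma T2_mirror: "0 < x + y \<Longrightarrow> T2 (\<lambda>t \<omega>. - W t \<omega>) (1 - \<gamma>) (y, x) = T1 W \<gamma> (x, y)"
  by (simp add: T1_eq_line_hit T2_eq_line_hit add.commute)

text \<open>\<open>(harmonic_p \<gamma> \<sigma>, harmonic_q \<gamma> \<sigma>)\<close> runs through the parabola of the exponents of harmonic exponentials.
The parameter is normalized so that \<open>\<sigma> - \<gamma>\<close> is the drift that the corresponding h-transform gives to
\<open>W\<close>: then \<open>\<sigma> = 0\<close> and \<open>\<sigma> = 1\<close> are the drifts parallel to the lower and to the upper line.\<close>

definition harmonic_p :: "real \<Rightarrow> real \<Rightarrow> real" where
  "harmonic_p \<gamma> \<sigma> = (\<gamma>\<^sup>2 - \<sigma>\<^sup>2) / 2"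

definition harmonic_q :: "real \<Rightarrow> real \<Rightarrow> real" where
  "harmonic_q \<gamma> \<sigma> = ((1 - \<gamma>)\<^sup>2 - (1 - \<sigma>)\<^sup>2) / 2"

definition harmonic_exp :: "real \<Rightarrow> real \<Rightarrow> real \<Rightarrow> real \<Rightarrow> real" where
  "harmonic_exp \<gamma> x y \<sigma> = exp (harmonic_p \<gamma> \<sigma> * x + harmonic_q \<gamma> \<sigma> * y)"

lemma harmonic_p_mirror: "harmonic_p (1 - \<gamma>) (1 - \<sigma>) = harmonic_q \<gamma> \<sigma>" and harmonic_q_mirror: "harmonic_q (1 - \<gamma>) (1 - \<sigma>) = harmonic_p \<gamma> \<sigma>"
  by (simp_all add: harmonic_p_def harmonic_q_def)

lemma harmonic_exp_mirror: "harmonic_exp (1 - \<gamma>) y x (1 - \<sigma>) = harmonic_exp \<gamma> x y \<sigma>"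
  by (simp add: harmonic_exp_def harmonic_p_mirror harmonic_q_mirror add.commute)

text \<open>The Laplace transform of the position \<open>x + y + T1\<close> on the vertical axis at the exit, as an extended
nonnegative number: this makes it meaningful, and monotone limits available, for positive \<open>q\<close> too.\<close>

definition exit_transform1 :: "'a measure \<Rightarrow> (real \<Rightarrow> 'a \<Rightarrow> real) \<Rightarrow> real \<Rightarrow> real \<Rightarrow> real \<Rightarrow> real \<Rightarrow> ennreal" where
  "exit_transform1 M W \<gamma> x y q =
     (\<integral>\<^sup>+\<omega>\<in>{\<omega>\<in>space M. T1 W \<gamma> (x, y) \<omega> < T2 W \<gamma> (x, y) \<omega>}.
        ennreal (exp (q * (x + y + real_of_ereal (T1 W \<gamma> (x, y) \<omega>)))) \<partial>M)"

definition exit_transform2 :: "'a measure \<Rightarrow> (real \<Rightarrow> 'a \<Rightarrow> real) \<Rightarrow> real \<Rightarrow> real \<Rightarrow> real \<Rightarrow> real \<Rightarrow> ennreal" where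
  "exit_transform2 M W \<gamma> x y p =
     (\<integral>\<^sup>+\<omega>\<in>{\<omega>\<in>space M. T2 W \<gamma> (x, y) \<omega> < T1 W \<gamma> (x, y) \<omega>}.
        ennreal (exp (p * (x + y + real_of_ereal (T2 W \<gamma> (x, y) \<omega>)))) \<partial>M)"

lemma exit_transform1_mirror: "0 < x + y \<Longrightarrow> exit_transform1 M (\<lambda>t \<omega>. - W t \<omega>) (1 - \<gamma>) y x = exit_transform2 M W \<gamma> x y"
  by (rule ext) (simp add: exit_transform1_def exit_transform2_def T1_mirror T2_mirror add.commute)

lemma exit_transform2_mirror: "0 < x + y \<Longrightarrow> exit_transform2 M (\<lambda>t \<omega>. - W t \<omega>) (1 - \<gamma>) y x = exit_transform1 M W \<gamma> x y"
  by (rule ext) (simp add: exit_transform1_def exit_transform2_def T1_mirror T2_mirror add.commute)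

locale wedge = brownian M W for M :: "'a measure" and W :: "real \<Rightarrow> 'a \<Rightarrow> real" +
  fixes \<gamma> x y :: real
  assumes \<gamma>: "0 < \<gamma>" "\<gamma> < 1" and xy: "0 < x" "0 < y"
begin

lemma wedge_mirror: "wedge M (\<lambda>t \<omega>. - W t \<omega>) (1 - \<gamma>) y x"
  using prob_space_axioms brownian_motion_uminus[OF brownian] \<gamma> xy
  by (simp add: wedge_def wedge_axioms_def brownian_def brownian_axioms_def)

lemma xy_pos: "0 < x + y" using xy by simp

abbreviation S :: "'a \<Rightarrow> ereal" where "S \<equiv> T1 W \<gamma> (x, y)"
abbreviation T :: "'a \<Rightarrow> ereal" where "T \<equiv> T2 W \<gamma> (x, y)"

lemma S_stopping_time: "0 \<le> u \<Longrightarrow> {\<omega>\<in>space M. S \<omega> \<le> ereal u} \<in> past u"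
  unfolding T1_eq_line_hit[OF xy_pos] using xy by (intro line_hit_stopping_time)

lemma T_stopping_time: "0 \<le> u \<Longrightarrow> {\<omega>\<in>space M. T \<omega> \<le> ereal u} \<in> past u"
proof -
  assume "0 \<le> u"
  interpret mirror: wedge M "\<lambda>t \<omega>. - W t \<omega>" "1 - \<gamma>" y x by (rule wedge_mirror)
  show ?thesis using mirror.S_stopping_time[OF \<open>0 \<le> u\<close>]
    unfolding generated_sets_uminus T1_mirror[OF xy_pos] .
qed

lemma S_nonneg: "0 \<le> S \<omega>" and T_nonneg: "0 \<le> T \<omega>"
  unfolding T1_eq_line_hit[OF xy_pos] T2_eq_line_hit[OF xy_pos] by (rule line_hit_nonneg)+

lemma first_exit_past:
  assumes "0 \<le> u"
  shows "{\<omega>\<in>space M. S \<omega> < T \<omega> \<and> S \<omega> \<le> ereal u} \<in> past u"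
  by (rule stopping_time_comparison[OF assms S_nonneg S_stopping_time T_stopping_time])

lemma measurable_S [measurable]: "S \<in> borel_measurable M"
  by (rule measurable_of_stopping_time[OF S_stopping_time S_nonneg])

lemma measurable_T [measurable]: "T \<in> borel_measurable M"
  by (rule measurable_of_stopping_time[OF T_stopping_time T_nonneg])

lemma S_attained:
  assumes "\<omega> \<in> space M" "S \<omega> \<noteq> \<infinity>"
  shows "\<exists>r\<ge>0. S \<omega> = ereal r \<and> W r \<omega> = x + (1 - \<gamma>) * r"
  using line_hit_attained[of \<omega> x "1 - \<gamma>"] assms by (simp add: T1_eq_line_hit[OF xy_pos])

lemma T_attained:
  assumes "\<omega> \<in> space M" "T \<omega> \<noteq> \<infinity>"
  shows "\<exists>r\<ge>0. T \<omega> = ereal r \<and> - W r \<omega> = y + \<gamma> * r"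
proof -
  interpret mirror: wedge M "\<lambda>t \<omega>. - W t \<omega>" "1 - \<gamma>" y x by (rule wedge_mirror)
  show ?thesis using mirror.S_attained[of \<omega>] assms by (simp add: T1_mirror[OF xy_pos])
qed

lemma S_eq_T_imp_infinite: "\<omega> \<in> space M \<Longrightarrow> S \<omega> = T \<omega> \<Longrightarrow> S \<omega> = \<infinity>"
proof (rule ccontr)
  assume w: "\<omega> \<in> space M" "S \<omega> = T \<omega>" "S \<omega> \<noteq> \<infinity>"
  then obtain r where "0 \<le> r" "W r \<omega> = x + (1 - \<gamma>) * r" "- W r \<omega> = y + \<gamma> * r"
    using S_attained[of \<omega>] T_attained[of \<omega>] by auto
  then have "x + y + r = 0" by (simp add: algebra_simps)
  with xy \<open>0 \<le> r\<close> show False by simp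
qed

lemma below_before_S:
  assumes "\<omega> \<in> space M" "0 \<le> t" "ereal t < S \<omega>"
  shows "W t \<omega> < x + (1 - \<gamma>) * t"
proof (rule ccontr)
  assume "\<not> ?thesis"
  then have "S \<omega> \<le> ereal t"
    unfolding T1_eq_line_hit[OF xy_pos] using assms(1,2) xy by (intro line_hit_le_if_above) auto
  with assms(3) show False by simp
qed

text \<open>On the vertical axis \<open>X = 0\<close> and \<open>Y = x + y + r\<close>, so the harmonic exponential there only involves
the exponent of \<open>y\<close>.\<close>

lemma harmonic_exp_wald_at_S:
  assumes "W r \<omega> = x + (1 - \<gamma>) * r"
  shows "harmonic_exp \<gamma> x y \<sigma> * wald (\<sigma> - \<gamma>) r \<omega> = exp (harmonic_q \<gamma> \<sigma> * (x + y + r))"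
proof -
  have 1: "harmonic_p \<gamma> \<sigma> = harmonic_q \<gamma> \<sigma> - (\<sigma> - \<gamma>)"
    by (simp add: harmonic_p_def harmonic_q_def field_simps power2_eq_square)
  have 2: "harmonic_q \<gamma> \<sigma> = (\<sigma> - \<gamma>) * (1 - \<gamma>) - (\<sigma> - \<gamma>)\<^sup>2 / 2"
    by (simp add: harmonic_q_def field_simps power2_eq_square)
  have "harmonic_p \<gamma> \<sigma> * x + harmonic_q \<gamma> \<sigma> * y + ((\<sigma> - \<gamma>) * (x + (1 - \<gamma>) * r) - (\<sigma> - \<gamma>)\<^sup>2 * r / 2)
      = harmonic_q \<gamma> \<sigma> * (x + y) + ((\<sigma> - \<gamma>) * (1 - \<gamma>) - (\<sigma> - \<gamma>)\<^sup>2 / 2) * r"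
    unfolding 1 by (simp add: algebra_simps)
  also have "\<dots> = harmonic_q \<gamma> \<sigma> * (x + y + r)"
    unfolding 2[symmetric] by (simp add: algebra_simps)
  finally show ?thesis
    unfolding harmonic_exp_def wald_def assms by (simp flip: exp_add)
qed

lemma stopped_exit_identity:
  assumes "0 < t"
  shows "ennreal (harmonic_exp \<gamma> x y \<sigma>) * (\<integral>\<^sup>+\<omega>\<in>{\<omega>\<in>space M. S \<omega> < T \<omega> \<and> S \<omega> \<le> ereal t}. ennreal (wald (\<sigma> - \<gamma>) t \<omega>) \<partial>M)
    = (\<integral>\<^sup>+\<omega>\<in>{\<omega>\<in>space M. S \<omega> < T \<omega> \<and> S \<omega> \<le> ereal t}. ennreal (exp (harmonic_q \<gamma> \<sigma> * (x + y + real_of_ereal (S \<omega>)))) \<partial>M)"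
proof -
  let ?A = "{\<omega>\<in>space M. S \<omega> < T \<omega> \<and> S \<omega> \<le> ereal t}"
  let ?\<tau> = "\<lambda>\<omega>. real_of_ereal (S \<omega>)"
  have att: "\<exists>r\<ge>0. S \<omega> = ereal r \<and> r \<le> t \<and> W r \<omega> = x + (1 - \<gamma>) * r" if "\<omega> \<in> ?A" for \<omega>
  proof -
    have "S \<omega> \<noteq> \<infinity>" using that by auto
    then show ?thesis using S_attained[of \<omega>] that by auto
  qed
  have eq: "(\<integral>\<^sup>+\<omega>\<in>?A. ennreal (wald (\<sigma> - \<gamma>) t \<omega>) \<partial>M) = (\<integral>\<^sup>+\<omega>\<in>?A. ennreal (wald (\<sigma> - \<gamma>) (?\<tau> \<omega>) \<omega>) \<partial>M)"
  proof (rule optional_stopping_wald[OF assms])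
    show "0 \<le> ?\<tau> \<omega> \<and> ?\<tau> \<omega> \<le> t" if "\<omega> \<in> ?A" for \<omega>
      using att[OF that] by auto
    fix u assume u: "0 \<le> u" "u \<le> t"
    have "{\<omega>\<in>?A. ?\<tau> \<omega> \<le> u} = {\<omega>\<in>space M. S \<omega> < T \<omega> \<and> S \<omega> \<le> ereal u}"
    proof (intro set_eqI iffI)
      fix \<omega> assume "\<omega> \<in> {\<omega>\<in>?A. ?\<tau> \<omega> \<le> u}"
      with att[of \<omega>] show "\<omega> \<in> {\<omega>\<in>space M. S \<omega> < T \<omega> \<and> S \<omega> \<le> ereal u}" by auto
    next
      fix \<omega> assume a: "\<omega> \<in> {\<omega>\<in>space M. S \<omega> < T \<omega> \<and> S \<omega> \<le> ereal u}"
      moreover have "S \<omega> \<le> ereal t" using a u by (auto intro: order_trans)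
      ultimately have "\<omega> \<in> ?A" by simp
      with att[of \<omega>] a show "\<omega> \<in> {\<omega>\<in>?A. ?\<tau> \<omega> \<le> u}" by auto
    qed
    then show "{\<omega>\<in>?A. ?\<tau> \<omega> \<le> u} \<in> past u" using first_exit_past[OF u(1)] by simp
  qed
  have A [measurable]: "?A \<in> sets M" by measurable
  have val: "ennreal (harmonic_exp \<gamma> x y \<sigma>) * (ennreal (wald (\<sigma> - \<gamma>) (?\<tau> \<omega>) \<omega>) * indicator ?A \<omega>)
      = ennreal (exp (harmonic_q \<gamma> \<sigma> * (x + y + ?\<tau> \<omega>))) * indicator ?A \<omega>" for \<omega>
  proof (cases "\<omega> \<in> ?A")
    case True
    then have "harmonic_exp \<gamma> x y \<sigma> * wald (\<sigma> - \<gamma>) (?\<tau> \<omega>) \<omega> = exp (harmonic_q \<gamma> \<sigma> * (x + y + ?\<tau> \<omega>))"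
      using att[OF True] by (intro harmonic_exp_wald_at_S) auto
    then show ?thesis using True by (simp add: harmonic_exp_def flip: ennreal_mult')
  qed simp
  have em: "(\<lambda>\<omega>. ennreal (exp (harmonic_q \<gamma> \<sigma> * (x + y + ?\<tau> \<omega>))) * indicator ?A \<omega>) \<in> borel_measurable M"
    by measurable
  have wm': "(\<lambda>\<omega>. ennreal (wald (\<sigma> - \<gamma>) (?\<tau> \<omega>) \<omega>) * indicator ?A \<omega>) \<in> borel_measurable M"
  proof -
    have "ennreal (wald (\<sigma> - \<gamma>) (?\<tau> \<omega>) \<omega>) * indicator ?A \<omega> =
        ennreal (1 / harmonic_exp \<gamma> x y \<sigma>) * (ennreal (exp (harmonic_q \<gamma> \<sigma> * (x + y + ?\<tau> \<omega>))) * indicator ?A \<omega>)" for \<omega>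
      unfolding val[symmetric] by (simp add: harmonic_exp_def mult.assoc[symmetric] flip: ennreal_mult')
    with em show ?thesis by simp
  qed
  show ?thesis
    unfolding eq nn_integral_cmult[OF wm', symmetric] val ..
qed

lemma truncated_exit_transform1_lim:
  "(\<lambda>n. \<integral>\<^sup>+\<omega>\<in>{\<omega>\<in>space M. S \<omega> < T \<omega> \<and> S \<omega> \<le> ereal (Suc n)}. ennreal (exp (q * (x + y + real_of_ereal (S \<omega>)))) \<partial>M)
     \<longlonglongrightarrow> exit_transform1 M W \<gamma> x y q"
  unfolding exit_transform1_def
proof (rule nn_integral_LIMSEQ)
  let ?A = "\<lambda>n. {\<omega>\<in>space M. S \<omega> < T \<omega> \<and> S \<omega> \<le> ereal (Suc n)}"
  let ?g = "\<lambda>\<omega>. ennreal (exp (q * (x + y + real_of_ereal (S \<omega>))))"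
  have mono: "?A m \<subseteq> ?A n" if "m \<le> n" for m n
    using that by (auto intro: order_trans)
  show "incseq (\<lambda>n \<omega>. ?g \<omega> * indicator (?A n) \<omega>)"
  proof (intro incseq_SucI le_funI mult_left_mono)
    fix n \<omega> show "(indicator (?A n) \<omega> :: ennreal) \<le> indicator (?A (Suc n)) \<omega>"
      using mono[of n "Suc n"] by (auto simp: indicator_def)
  qed simp
  show "(\<lambda>\<omega>. ?g \<omega> * indicator (?A n) \<omega>) \<in> borel_measurable M" for n
    by measurable
  fix \<omega>
  show "(\<lambda>n. ?g \<omega> * indicator (?A n) \<omega>) \<longlonglongrightarrow> ?g \<omega> * indicator {\<omega>\<in>space M. S \<omega> < T \<omega>} \<omega>"
  proof (cases "\<omega> \<in> space M \<and> S \<omega> < T \<omega>")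
    case True
    then obtain r where r: "S \<omega> = ereal r" using S_nonneg[of \<omega>] by (cases "S \<omega>") auto
    obtain N where "r \<le> real N" using real_arch_simple by blast
    then have "\<omega> \<in> ?A n" if "N \<le> n" for n using that True r by auto
    then have "\<forall>\<^sub>F n in sequentially. ?g \<omega> * indicator {\<omega>\<in>space M. S \<omega> < T \<omega>} \<omega> = ?g \<omega> * indicator (?A n) \<omega>"
      using True by (intro eventually_sequentiallyI[of N]) (simp add: indicator_def)
    then show ?thesis by (rule Lim_transform_eventually[OF tendsto_const])
  qed (auto simp: indicator_def)
qed

text \<open>Before the upper line is met, the path is bounded above, and so the densities for the drifts \<open>\<sigma> - \<gamma>\<close>
and \<open>1 - \<gamma>\<close> can be compared.  Their quotient decays exponentially in time, which is a Chernoff bound for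
the probability that a motion faster than the line has not yet met it.\<close>

lemma wald_on_survival_le:
  assumes "1 < \<sigma>" "0 \<le> t" "W t \<omega> < x + (1 - \<gamma>) * t"
  shows "wald (\<sigma> - \<gamma>) t \<omega> \<le> exp ((\<sigma> - 1) * x - (\<sigma> - 1)\<^sup>2 / 2 * t) * wald (1 - \<gamma>) t \<omega>"
proof -
  have "(\<sigma> - 1) * W t \<omega> \<le> (\<sigma> - 1) * (x + (1 - \<gamma>) * t)"
    using assms by (intro mult_left_mono) auto
  then have "(\<sigma> - \<gamma>) * W t \<omega> - (\<sigma> - \<gamma>)\<^sup>2 * t / 2
      \<le> ((\<sigma> - 1) * x - (\<sigma> - 1)\<^sup>2 / 2 * t) + ((1 - \<gamma>) * W t \<omega> - (1 - \<gamma>)\<^sup>2 * t / 2)"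
    by (simp add: field_simps power2_eq_square)
  then show ?thesis by (simp add: wald_def flip: exp_add)
qed

lemma survival_lim:
  assumes "1 < \<sigma>"
  shows "(\<lambda>n. \<integral>\<^sup>+\<omega>\<in>{\<omega>\<in>space M. ereal (Suc n) < S \<omega> \<and> ereal (Suc n) < T \<omega>}. ennreal (wald (\<sigma> - \<gamma>) (Suc n) \<omega>) \<partial>M) \<longlonglongrightarrow> 0"
proof (rule tendsto_sandwich[where f = "\<lambda>_. 0"])
  let ?C = "\<lambda>n. exp ((\<sigma> - 1) * x - (\<sigma> - 1)\<^sup>2 / 2 * real (Suc n))"
  let ?R = "\<lambda>n. {\<omega>\<in>space M. ereal (Suc n) < S \<omega> \<and> ereal (Suc n) < T \<omega>}"
  have "(\<integral>\<^sup>+\<omega>\<in>?R n. ennreal (wald (\<sigma> - \<gamma>) (Suc n) \<omega>) \<partial>M) \<le> ennreal (?C n)" for n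
  proof -
    have "ennreal (wald (\<sigma> - \<gamma>) (Suc n) \<omega>) * indicator (?R n) \<omega> \<le> ennreal (?C n) * ennreal (wald (1 - \<gamma>) (Suc n) \<omega>)" for \<omega>
    proof (cases "\<omega> \<in> ?R n")
      case True
      then have "wald (\<sigma> - \<gamma>) (Suc n) \<omega> \<le> ?C n * wald (1 - \<gamma>) (Suc n) \<omega>"
        by (intro wald_on_survival_le assms below_before_S) (simp_all del: of_nat_Suc)
      with True show ?thesis by (simp add: ennreal_leI flip: ennreal_mult' del: of_nat_Suc)
    qed simp
    then have "(\<integral>\<^sup>+\<omega>\<in>?R n. ennreal (wald (\<sigma> - \<gamma>) (Suc n) \<omega>) \<partial>M) \<le> (\<integral>\<^sup>+\<omega>. ennreal (?C n) * ennreal (wald (1 - \<gamma>) (Suc n) \<omega>) \<partial>M)"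
      by (intro nn_integral_mono)
    also have "\<dots> = ennreal (?C n)"
      by (subst nn_integral_cmult) (simp_all add: nn_integral_wald del: of_nat_Suc)
    finally show ?thesis .
  qed
  then show "\<forall>\<^sub>F n in sequentially. (\<integral>\<^sup>+\<omega>\<in>?R n. ennreal (wald (\<sigma> - \<gamma>) (Suc n) \<omega>) \<partial>M) \<le> ennreal (?C n)"
    by (intro always_eventually allI)
  have "?C \<longlonglongrightarrow> 0"
    using assms by real_asymp
  then show "(\<lambda>n. ennreal (?C n)) \<longlonglongrightarrow> 0" using tendsto_ennrealI by fastforce
qed simp_all

text \<open>The total mass 1 of the density at time \<open>t\<close>, split according to whether the quadrant has been left
through the vertical axis, through the horizontal axis, or not at all.\<close>

lemma exit_split:
  assumes "0 < t"
  shows "ennreal (harmonic_exp \<gamma> x y \<sigma>) =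
     (\<integral>\<^sup>+\<omega>\<in>{\<omega>\<in>space M. S \<omega> < T \<omega> \<and> S \<omega> \<le> ereal t}. ennreal (exp (harmonic_q \<gamma> \<sigma> * (x + y + real_of_ereal (S \<omega>)))) \<partial>M)
   + (\<integral>\<^sup>+\<omega>\<in>{\<omega>\<in>space M. T \<omega> < S \<omega> \<and> T \<omega> \<le> ereal t}. ennreal (exp (harmonic_p \<gamma> \<sigma> * (x + y + real_of_ereal (T \<omega>)))) \<partial>M)
   + ennreal (harmonic_exp \<gamma> x y \<sigma>) *
     (\<integral>\<^sup>+\<omega>\<in>{\<omega>\<in>space M. ereal t < S \<omega> \<and> ereal t < T \<omega>}. ennreal (wald (\<sigma> - \<gamma>) t \<omega>) \<partial>M)"
proof -
  interpret mirror: wedge M "\<lambda>t \<omega>. - W t \<omega>" "1 - \<gamma>" y x by (rule wedge_mirror)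
  let ?A = "{\<omega>\<in>space M. S \<omega> < T \<omega> \<and> S \<omega> \<le> ereal t}"
  let ?B = "{\<omega>\<in>space M. T \<omega> < S \<omega> \<and> T \<omega> \<le> ereal t}"
  let ?R = "{\<omega>\<in>space M. ereal t < S \<omega> \<and> ereal t < T \<omega>}"
  let ?w = "\<lambda>\<omega>. ennreal (wald (\<sigma> - \<gamma>) t \<omega>)"
  have mw: "mirror.wald (1 - \<sigma> - (1 - \<gamma>)) t = wald (\<sigma> - \<gamma>) t"
    by (simp add: mirror.wald_def wald_def fun_eq_iff field_simps power2_eq_square)
  have B: "ennreal (harmonic_exp \<gamma> x y \<sigma>) * (\<integral>\<^sup>+\<omega>\<in>?B. ?w \<omega> \<partial>M)
    = (\<integral>\<^sup>+\<omega>\<in>?B. ennreal (exp (harmonic_p \<gamma> \<sigma> * (x + y + real_of_ereal (T \<omega>)))) \<partial>M)"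
    using mirror.stopped_exit_identity[OF assms, of "1 - \<sigma>"]
    unfolding mw T1_mirror[OF xy_pos] T2_mirror[OF xy_pos] harmonic_exp_mirror harmonic_q_mirror add.commute[of y x] .
  have one: "indicator ?A \<omega> + indicator ?B \<omega> + indicator ?R \<omega> = (1::ennreal)" if "\<omega> \<in> space M" for \<omega>
  proof -
    consider "S \<omega> < T \<omega>" | "T \<omega> < S \<omega>" | "S \<omega> = T \<omega>" by (rule linorder_cases)
    then show ?thesis
    proof cases
      case 3
      with S_eq_T_imp_infinite[OF that] that show ?thesis by (simp add: indicator_def)
    qed (use that in \<open>auto simp: indicator_def not_le intro: less_trans dest: le_less_trans\<close>)
  qed
  have [measurable]: "?A \<in> sets M" "?B \<in> sets M" "?R \<in> sets M" by measurable
  have [measurable]: "wald (\<sigma> - \<gamma>) t \<in> borel_measurable M"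
    using assms by (intro measurable_wald) simp
  have "1 = (\<integral>\<^sup>+\<omega>. ?w \<omega> * (indicator ?A \<omega> + indicator ?B \<omega> + indicator ?R \<omega>) \<partial>M)"
    using assms by (simp add: one nn_integral_wald cong: nn_integral_cong_simp)
  also have "\<dots> = (\<integral>\<^sup>+\<omega>\<in>?A. ?w \<omega> \<partial>M) + (\<integral>\<^sup>+\<omega>\<in>?B. ?w \<omega> \<partial>M) + (\<integral>\<^sup>+\<omega>\<in>?R. ?w \<omega> \<partial>M)"
    by (simp add: distrib_left nn_integral_add)
  finally have "ennreal (harmonic_exp \<gamma> x y \<sigma>) * 1 = ennreal (harmonic_exp \<gamma> x y \<sigma>) *
      ((\<integral>\<^sup>+\<omega>\<in>?A. ?w \<omega> \<partial>M) + (\<integral>\<^sup>+\<omega>\<in>?B. ?w \<omega> \<partial>M) + (\<integral>\<^sup>+\<omega>\<in>?R. ?w \<omega> \<partial>M))" by simp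
  then show ?thesis
    unfolding stopped_exit_identity[OF assms, symmetric] B[symmetric] by (simp add: distrib_left)
qed

lemma truncated_exit_transform2_lim:
  "(\<lambda>n. \<integral>\<^sup>+\<omega>\<in>{\<omega>\<in>space M. T \<omega> < S \<omega> \<and> T \<omega> \<le> ereal (Suc n)}. ennreal (exp (p * (x + y + real_of_ereal (T \<omega>)))) \<partial>M)
     \<longlonglongrightarrow> exit_transform2 M W \<gamma> x y p"
proof -
  interpret mirror: wedge M "\<lambda>t \<omega>. - W t \<omega>" "1 - \<gamma>" y x by (rule wedge_mirror)
  show ?thesis using mirror.truncated_exit_transform1_lim[of p]
    unfolding T1_mirror[OF xy_pos] T2_mirror[OF xy_pos] exit_transform1_mirror[OF xy_pos] add.commute[of y x] .
qed

lemma exit_balance_supercritical: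
  assumes "1 < \<sigma>"
  shows "ennreal (harmonic_exp \<gamma> x y \<sigma>) = exit_transform1 M W \<gamma> x y (harmonic_q \<gamma> \<sigma>) + exit_transform2 M W \<gamma> x y (harmonic_p \<gamma> \<sigma>)"
proof -
  let ?f = "\<lambda>n. (\<integral>\<^sup>+\<omega>\<in>{\<omega>\<in>space M. S \<omega> < T \<omega> \<and> S \<omega> \<le> ereal (Suc n)}. ennreal (exp (harmonic_q \<gamma> \<sigma> * (x + y + real_of_ereal (S \<omega>)))) \<partial>M)
   + (\<integral>\<^sup>+\<omega>\<in>{\<omega>\<in>space M. T \<omega> < S \<omega> \<and> T \<omega> \<le> ereal (Suc n)}. ennreal (exp (harmonic_p \<gamma> \<sigma> * (x + y + real_of_ereal (T \<omega>)))) \<partial>M)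
   + ennreal (harmonic_exp \<gamma> x y \<sigma>) *
     (\<integral>\<^sup>+\<omega>\<in>{\<omega>\<in>space M. ereal (Suc n) < S \<omega> \<and> ereal (Suc n) < T \<omega>}. ennreal (wald (\<sigma> - \<gamma>) (Suc n) \<omega>) \<partial>M)"
  have "?f \<longlonglongrightarrow> exit_transform1 M W \<gamma> x y (harmonic_q \<gamma> \<sigma>) + exit_transform2 M W \<gamma> x y (harmonic_p \<gamma> \<sigma>) + ennreal (harmonic_exp \<gamma> x y \<sigma>) * 0"
    by (intro tendsto_add truncated_exit_transform1_lim truncated_exit_transform2_lim ennreal_tendsto_cmult survival_lim assms) simp
  moreover have "?f = (\<lambda>n. ennreal (harmonic_exp \<gamma> x y \<sigma>))"
    by (intro ext exit_split[symmetric]) simp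
  ultimately show ?thesis by (simp add: LIMSEQ_const_iff)
qed

text \<open>At \<open>\<sigma> = 1\<close> the drift is parallel to the upper line and the exponential bound on survival degenerates.
The identity is obtained as the limit of \<open>\<sigma> \<down> 1\<close> instead: the exponent \<open>q\<close> increases, so the
first transform converges monotonically, and the exponent \<open>p\<close> stays nonpositive, so the second one
converges with dominating function 1.\<close>

lemma exit_balance_critical:
  "ennreal (harmonic_exp \<gamma> x y 1) = exit_transform1 M W \<gamma> x y (harmonic_q \<gamma> 1) + exit_transform2 M W \<gamma> x y (harmonic_p \<gamma> 1)"
proof -
  define s where "s n = 1 + inverse (real (Suc n))" for n
  have s1: "1 < s n" for n by (simp add: s_def)
  have s_anti: "s (Suc n) \<le> s n" for n by (simp add: s_def field_simps)
  have s_lim: "s \<longlonglongrightarrow> 1"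
    unfolding s_def using tendsto_add[OF tendsto_const LIMSEQ_inverse_real_of_nat, of 1] by simp
  have q_lim: "(\<lambda>n. harmonic_q \<gamma> (s n)) \<longlonglongrightarrow> harmonic_q \<gamma> 1" and p_lim: "(\<lambda>n. harmonic_p \<gamma> (s n)) \<longlonglongrightarrow> harmonic_p \<gamma> 1"
    unfolding harmonic_q_def harmonic_p_def by (intro tendsto_intros s_lim; simp)+
  have h_lim: "(\<lambda>n. harmonic_exp \<gamma> x y (s n)) \<longlonglongrightarrow> harmonic_exp \<gamma> x y 1"
    unfolding harmonic_exp_def by (intro tendsto_intros q_lim p_lim)
  have q_mono: "harmonic_q \<gamma> (s n) \<le> harmonic_q \<gamma> (s (Suc n))" for n
  proof -
    have "(s (Suc n) - 1)\<^sup>2 \<le> (s n - 1)\<^sup>2"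
      using s1[of "Suc n"] s_anti[of n] by (intro power_mono) auto
    then show ?thesis by (simp add: harmonic_q_def power2_commute)
  qed
  have p_neg: "harmonic_p \<gamma> (s n) \<le> 0" for n
  proof -
    have "\<gamma>\<^sup>2 \<le> (s n)\<^sup>2" using \<gamma> s1[of n] by (intro power_mono) auto
    then show ?thesis by (simp add: harmonic_p_def)
  qed
  have c: "0 \<le> x + y + real_of_ereal (S \<omega>)" "0 \<le> x + y + real_of_ereal (T \<omega>)" for \<omega>
    using xy S_nonneg[of \<omega>] T_nonneg[of \<omega>] by (simp_all add: real_of_ereal_pos)
  have "(\<lambda>n. exit_transform1 M W \<gamma> x y (harmonic_q \<gamma> (s n))) \<longlonglongrightarrow> exit_transform1 M W \<gamma> x y (harmonic_q \<gamma> 1)"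
    unfolding exit_transform1_def
  proof (rule nn_integral_LIMSEQ)
    let ?g = "\<lambda>q \<omega>. ennreal (exp (q * (x + y + real_of_ereal (S \<omega>)))) * indicator {\<omega>\<in>space M. S \<omega> < T \<omega>} \<omega>"
    show "incseq (\<lambda>n. ?g (harmonic_q \<gamma> (s n)))"
      using q_mono c by (intro incseq_SucI le_funI mult_right_mono ennreal_leI) (auto intro: mult_right_mono)
    show "?g (harmonic_q \<gamma> (s n)) \<in> borel_measurable M" for n by measurable
    show "(\<lambda>n. ?g (harmonic_q \<gamma> (s n)) \<omega>) \<longlonglongrightarrow> ?g (harmonic_q \<gamma> 1) \<omega>" for \<omega>
      by (intro tendsto_mult_ennreal tendsto_const tendsto_ennrealI tendsto_intros q_lim) (auto simp: indicator_def)
  qed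
  moreover have "(\<lambda>n. exit_transform2 M W \<gamma> x y (harmonic_p \<gamma> (s n))) \<longlonglongrightarrow> exit_transform2 M W \<gamma> x y (harmonic_p \<gamma> 1)"
    unfolding exit_transform2_def
  proof (rule nn_integral_dominated_convergence[where w = "\<lambda>_. 1"])
    let ?g = "\<lambda>p \<omega>. ennreal (exp (p * (x + y + real_of_ereal (T \<omega>)))) * indicator {\<omega>\<in>space M. T \<omega> < S \<omega>} \<omega>"
    show "?g (harmonic_p \<gamma> (s n)) \<in> borel_measurable M" "?g (harmonic_p \<gamma> 1) \<in> borel_measurable M" for n by measurable
    show "AE \<omega> in M. ?g (harmonic_p \<gamma> (s n)) \<omega> \<le> 1" for n
      using p_neg[of n] c(2) by (intro AE_I2) (auto simp: indicator_def mult_nonpos_nonneg)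
    show "AE \<omega> in M. (\<lambda>n. ?g (harmonic_p \<gamma> (s n)) \<omega>) \<longlonglongrightarrow> ?g (harmonic_p \<gamma> 1) \<omega>"
      by (intro AE_I2 tendsto_mult_ennreal tendsto_const tendsto_ennrealI tendsto_intros p_lim) (auto simp: indicator_def)
  qed (simp_all add: emeasure_space_1)
  ultimately have "(\<lambda>n. ennreal (harmonic_exp \<gamma> x y (s n))) \<longlonglongrightarrow> exit_transform1 M W \<gamma> x y (harmonic_q \<gamma> 1) + exit_transform2 M W \<gamma> x y (harmonic_p \<gamma> 1)"
    unfolding exit_balance_supercritical[OF s1] by (intro tendsto_add)
  with tendsto_ennrealI[OF h_lim] show ?thesis by (rule LIMSEQ_unique)
qed

text \<open>For these \<open>\<sigma>\<close> the motion with drift \<open>\<sigma> - \<gamma>\<close> leaves the quadrant almost surely, so the harmonic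
exponential at the starting point is the sum of its averages over the two sides.\<close>

lemma exit_balance:
  assumes "\<sigma> \<le> 0 \<or> 1 \<le> \<sigma>"
  shows "ennreal (harmonic_exp \<gamma> x y \<sigma>) = exit_transform1 M W \<gamma> x y (harmonic_q \<gamma> \<sigma>) + exit_transform2 M W \<gamma> x y (harmonic_p \<gamma> \<sigma>)"
proof -
  interpret mirror: wedge M "\<lambda>t \<omega>. - W t \<omega>" "1 - \<gamma>" y x by (rule wedge_mirror)
  consider "1 < \<sigma>" | "\<sigma> = 1" | "1 < 1 - \<sigma>" | "\<sigma> = 0" using assms by linarith
  then show ?thesis
  proof cases
    case 3
    show ?thesis
      using mirror.exit_balance_supercritical[OF 3]
      unfolding harmonic_exp_mirror harmonic_p_mirror harmonic_q_mirror exit_transform1_mirror[OF xy_pos] exit_transform2_mirror[OF xy_pos]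
      by (simp add: add.commute)
  next
    case 4
    show ?thesis
      using mirror.exit_balance_critical harmonic_exp_mirror[of \<gamma> y x 0] harmonic_p_mirror[of \<gamma> 0] harmonic_q_mirror[of \<gamma> 0] 4
      unfolding exit_transform1_mirror[OF xy_pos] exit_transform2_mirror[OF xy_pos]
      by (simp add: add.commute)
  qed (use exit_balance_supercritical exit_balance_critical in auto)
qed

end

section \<open>Laplace transforms, h-transform and alternating series\<close>

context wedge begin

lemma exit_finite:
  assumes "\<sigma> \<le> 0 \<or> 1 \<le> \<sigma>"
  shows "exit_transform1 M W \<gamma> x y (harmonic_q \<gamma> \<sigma>) < \<top>" "exit_transform2 M W \<gamma> x y (harmonic_p \<gamma> \<sigma>) < \<top>"
proof -
  have "exit_transform1 M W \<gamma> x y (harmonic_q \<gamma> \<sigma>) + exit_transform2 M W \<gamma> x y (harmonic_p \<gamma> \<sigma>) < \<top>"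
    unfolding exit_balance[OF assms, symmetric] by simp
  then show "exit_transform1 M W \<gamma> x y (harmonic_q \<gamma> \<sigma>) < \<top>" "exit_transform2 M W \<gamma> x y (harmonic_p \<gamma> \<sigma>) < \<top>"
    by (simp_all add: ennreal_add_less_top)
qed

lemma exit_balance_real:
  assumes "\<sigma> \<le> 0 \<or> 1 \<le> \<sigma>"
  shows "harmonic_exp \<gamma> x y \<sigma> = enn2real (exit_transform1 M W \<gamma> x y (harmonic_q \<gamma> \<sigma>)) + enn2real (exit_transform2 M W \<gamma> x y (harmonic_p \<gamma> \<sigma>))"
proof -
  have "harmonic_exp \<gamma> x y \<sigma> = enn2real (ennreal (harmonic_exp \<gamma> x y \<sigma>))" by (simp add: harmonic_exp_def)
  then show ?thesis
    using exit_finite[OF assms] by (simp add: exit_balance[OF assms] enn2real_plus)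
qed

lemma laplace1_eq: "laplace1 M W \<gamma> (x, y) (of_real q) = of_real (enn2real (exit_transform1 M W \<gamma> x y q))"
proof -
  let ?g = "\<lambda>\<omega>. exp (q * (x + y + real_of_ereal (S \<omega>))) * indicator {\<omega>\<in>space M. S \<omega> < T \<omega>} \<omega>"
  have "exp (of_real q * complex_of_real (snd (Z W \<gamma> (x, y) (real_of_ereal (S \<omega>)) \<omega>)))
        * indicator {\<omega>. S \<omega> < T \<omega>} \<omega> = complex_of_real (?g \<omega>)" if w: "\<omega> \<in> space M" for \<omega>
  proof (cases "S \<omega> < T \<omega>")
    case True
    then have "S \<omega> \<noteq> \<infinity>" by auto
    then obtain r where "S \<omega> = ereal r" "W r \<omega> = x + (1 - \<gamma>) * r"
      using S_attained[OF w] by blast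
    then have "snd (Z W \<gamma> (x, y) (real_of_ereal (S \<omega>)) \<omega>) = x + y + real_of_ereal (S \<omega>)"
      by (simp add: Z_def displacement_def algebra_simps)
    then show ?thesis using True w by (simp flip: exp_of_real)
  qed simp
  then have "laplace1 M W \<gamma> (x, y) (of_real q) = (\<integral>\<omega>. complex_of_real (?g \<omega>) \<partial>M)"
    unfolding laplace1_def by (intro Bochner_Integration.integral_cong) simp_all
  also have "\<dots> = of_real (\<integral>\<omega>. ?g \<omega> \<partial>M)" by (rule integral_complex_of_real)
  also have "(\<integral>\<omega>. ?g \<omega> \<partial>M) = enn2real (\<integral>\<^sup>+\<omega>. ennreal (?g \<omega>) \<partial>M)"
  proof (rule integral_eq_nn_integral)
    show "?g \<in> borel_measurable M" by measurable
    show "AE \<omega> in M. 0 \<le> ?g \<omega>" by simp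
  qed
  also have "(\<integral>\<^sup>+\<omega>. ennreal (?g \<omega>) \<partial>M) = exit_transform1 M W \<gamma> x y q"
    unfolding exit_transform1_def by (intro nn_integral_cong) (simp add: indicator_def)
  finally show ?thesis .
qed

end

lemma laplace2_mirror:
  "0 < x + y \<Longrightarrow> laplace2 M (\<lambda>t \<omega>. - W t \<omega>) (1 - \<gamma>) (y, x) q = laplace1 M W \<gamma> (x, y) q"
  by (simp add: laplace1_def laplace2_def T1_mirror T2_mirror Z_def displacement_def)

lemma laplace1_mirror:
  "0 < x + y \<Longrightarrow> laplace1 M (\<lambda>t \<omega>. - W t \<omega>) (1 - \<gamma>) (y, x) q = laplace2 M W \<gamma> (x, y) q"
  by (simp add: laplace1_def laplace2_def T1_mirror T2_mirror Z_def displacement_def)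

lemma L1_mirror:
  "0 < x + y \<Longrightarrow> L1 M (\<lambda>t \<omega>. - W t \<omega>) (1 - \<gamma>) (y, x) q = L2 M W \<gamma> (x, y) q"
  by (simp add: L1_def L2_def laplace1_mirror laplace2_mirror P_minus_def Q_minus_def add.commute)

context wedge begin

lemma laplace2_eq: "laplace2 M W \<gamma> (x, y) (of_real p) = of_real (enn2real (exit_transform2 M W \<gamma> x y p))"
proof -
  interpret mirror: wedge M "\<lambda>t \<omega>. - W t \<omega>" "1 - \<gamma>" y x by (rule wedge_mirror)
  show ?thesis using mirror.laplace1_eq[of p]
    unfolding laplace1_mirror[OF xy_pos] exit_transform1_mirror[OF xy_pos] .
qed

text \<open>For \<open>\<sigma> \<le> 1\<close> the branch of the square root taken by \<open>P_minus\<close> selects, of the two points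
\<open>\<sigma>\<close> and \<open>2 - \<sigma>\<close> of the parabola with this second coordinate, the one on the far side of 1, where
\<open>exit_balance\<close> applies.\<close>

lemma P_minus_harmonic_q:
  assumes "\<sigma> \<le> 1"
  shows "P_minus \<gamma> (of_real (harmonic_q \<gamma> \<sigma>)) = of_real (harmonic_p \<gamma> (2 - \<sigma>))"
proof -
  have "(1 - of_real \<gamma>)\<^sup>2 - 2 * complex_of_real (harmonic_q \<gamma> \<sigma>) = of_real ((1 - \<gamma>)\<^sup>2 - 2 * harmonic_q \<gamma> \<sigma>)"
    by simp
  also have "(1 - \<gamma>)\<^sup>2 - 2 * harmonic_q \<gamma> \<sigma> = (1 - \<sigma>)\<^sup>2" by (simp add: harmonic_q_def field_simps)
  finally have "csqrt ((1 - of_real \<gamma>)\<^sup>2 - 2 * complex_of_real (harmonic_q \<gamma> \<sigma>)) = of_real (1 - \<sigma>)"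
    using assms by (simp add: real_sqrt_abs del: of_real_power of_real_diff)
  then have "P_minus \<gamma> (of_real (harmonic_q \<gamma> \<sigma>)) = of_real (\<gamma> - 1 + harmonic_q \<gamma> \<sigma> - (1 - \<sigma>))"
    unfolding P_minus_def by simp
  also have "\<gamma> - 1 + harmonic_q \<gamma> \<sigma> - (1 - \<sigma>) = harmonic_p \<gamma> (2 - \<sigma>)"
    by (simp add: harmonic_p_def harmonic_q_def field_simps power2_eq_square)
  finally show ?thesis .
qed

lemma harmonic_q_reflect: "harmonic_q \<gamma> (2 - \<sigma>) = harmonic_q \<gamma> \<sigma>"
  by (simp add: harmonic_q_def power2_eq_square algebra_simps)

lemma harmonic_p_reflect: "harmonic_p \<gamma> (- \<sigma>) = harmonic_p \<gamma> \<sigma>"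
  by (simp add: harmonic_p_def)

text \<open>For a negative argument \<open>L1\<close> is the expectation itself; otherwise it is defined by continuation, and the
continuation formula is the balance of exits at \<open>2 - \<sigma>\<close>.\<close>

lemma L1_eq_exit_transform1:
  assumes "\<sigma> \<le> 1"
  shows "L1 M W \<gamma> (x, y) (of_real (harmonic_q \<gamma> \<sigma>)) = of_real (enn2real (exit_transform1 M W \<gamma> x y (harmonic_q \<gamma> \<sigma>)))"
proof (cases "harmonic_q \<gamma> \<sigma> < 0")
  case True
  then show ?thesis by (simp add: L1_def laplace1_eq)
next
  case False
  have "L1 M W \<gamma> (x, y) (of_real (harmonic_q \<gamma> \<sigma>)) =
      of_real (harmonic_exp \<gamma> x y (2 - \<sigma>)) - of_real (enn2real (exit_transform2 M W \<gamma> x y (harmonic_p \<gamma> (2 - \<sigma>))))"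
    using False by (simp add: L1_def P_minus_harmonic_q[OF assms] laplace2_eq harmonic_exp_def harmonic_q_reflect exp_of_real flip: of_real_mult of_real_add)
  then show ?thesis
    using exit_balance_real[of "2 - \<sigma>"] assms by (simp add: harmonic_q_reflect)
qed

text \<open>By optional stopping, the h-transform gives to the exit through the vertical axis before time \<open>t\<close> the
average of the harmonic exponential over that exit, divided by its value at the starting point.  Truncation
at a finite time is essential, since the density is only available on the past of a finite time.\<close>

lemma exit_transform1_doob:
  assumes P: "prob_space P" "space P = space M" "generated_sets (space M) W {0..} \<subseteq> sets P"
    and dens: "\<And>t A. 0 \<le> t \<Longrightarrow> A \<in> past t \<Longrightarrow>
      emeasure P A = emeasure (density M (\<lambda>\<omega>. ennreal (exp ((harmonic_p \<gamma> \<sigma>, harmonic_q \<gamma> \<sigma>) \<bullet> displacement W \<gamma> t \<omega>)))) A"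
  shows "enn2real (exit_transform1 M W \<gamma> x y (harmonic_q \<gamma> \<sigma>)) = harmonic_exp \<gamma> x y \<sigma> * measure P {\<omega>\<in>space P. S \<omega> < T \<omega>}"
proof -
  interpret P: prob_space P by fact
  let ?A = "\<lambda>n. {\<omega>\<in>space M. S \<omega> < T \<omega> \<and> S \<omega> \<le> ereal (Suc n)}"
  have past_A: "?A n \<in> past (Suc n)" for n
    by (intro first_exit_past) simp
  have "past (real (Suc n)) \<subseteq> generated_sets (space M) W {0..}" for n
    unfolding generated_sets_def by (intro sigma_sets_mono') force
  then have A_sets: "range ?A \<subseteq> sets P"
    using past_A P(3) by blast
  have UN: "(\<Union>n. ?A n) = {\<omega>\<in>space P. S \<omega> < T \<omega>}"
  proof (intro set_eqI iffI)
    fix \<omega> assume a: "\<omega> \<in> {\<omega>\<in>space P. S \<omega> < T \<omega>}"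
    then obtain r where r: "S \<omega> = ereal r" using S_nonneg[of \<omega>] by (cases "S \<omega>") auto
    obtain N where "r \<le> real N" using real_arch_simple by blast
    then have "\<omega> \<in> ?A N" using a r P(2) by auto
    then show "\<omega> \<in> (\<Union>n. ?A n)" by blast
  qed (auto simp: P(2))
  \<comment> \<open>Harmonicity of the exponential: the coefficient of \<open>t\<close> is \<open>- (\<sigma> - \<gamma>)\<^sup>2 / 2\<close>.\<close>
  have wald_disp: "exp ((harmonic_p \<gamma> \<sigma>, harmonic_q \<gamma> \<sigma>) \<bullet> displacement W \<gamma> t \<omega>) = wald (\<sigma> - \<gamma>) t \<omega>" for t \<omega>
    by (simp add: wald_def displacement_def harmonic_p_def harmonic_q_def field_simps power2_eq_square)
  have "ennreal (harmonic_exp \<gamma> x y \<sigma>) * emeasure P (?A n) =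
      (\<integral>\<^sup>+\<omega>\<in>?A n. ennreal (exp (harmonic_q \<gamma> \<sigma> * (x + y + real_of_ereal (S \<omega>)))) \<partial>M)" for n
  proof -
    have "?A n \<in> sets M" using past_A past_subset_sets by blast
    moreover have "emeasure P (?A n) = emeasure (density M (\<lambda>\<omega>. ennreal (wald (\<sigma> - \<gamma>) (Suc n) \<omega>))) (?A n)"
      using dens[OF _ past_A[of n]] by (simp only: wald_disp of_nat_0_le_iff)
    ultimately have "emeasure P (?A n) = (\<integral>\<^sup>+\<omega>\<in>?A n. ennreal (wald (\<sigma> - \<gamma>) (Suc n) \<omega>) \<partial>M)"
      by (simp only:) (intro emeasure_density measurable_compose[OF measurable_wald measurable_ennreal], auto)
    then show ?thesis by (simp only: stopped_exit_identity of_nat_0_less_iff zero_less_Suc)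
  qed
  then have "(\<lambda>n. ennreal (harmonic_exp \<gamma> x y \<sigma>) * emeasure P (?A n)) \<longlonglongrightarrow> exit_transform1 M W \<gamma> x y (harmonic_q \<gamma> \<sigma>)"
    using truncated_exit_transform1_lim[of "harmonic_q \<gamma> \<sigma>"] by (simp only:)
  moreover have "(\<lambda>n. ennreal (harmonic_exp \<gamma> x y \<sigma>) * emeasure P (?A n)) \<longlonglongrightarrow>
      ennreal (harmonic_exp \<gamma> x y \<sigma>) * emeasure P (\<Union>n. ?A n)"
    by (intro ennreal_tendsto_cmult Lim_emeasure_incseq[OF A_sets] incseq_SucI) (auto intro: order_trans)
  ultimately have "exit_transform1 M W \<gamma> x y (harmonic_q \<gamma> \<sigma>) = ennreal (harmonic_exp \<gamma> x y \<sigma>) * emeasure P (\<Union>n. ?A n)"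
    by (rule LIMSEQ_unique)
  then show ?thesis
    unfolding UN by (simp add: enn2real_mult measure_def harmonic_exp_def)
qed

end

lemma alternating_telescope_has_sum:
  fixes r b :: "nat \<Rightarrow> real"
  assumes nonneg: "\<And>n. 0 \<le> r n" and step: "\<And>n. b n = r n + r (Suc n)" and b: "summable b"
  shows "((\<lambda>n. (-1) ^ n * b n) has_sum r 0) UNIV"
proof (rule norm_summable_imp_has_sum)
  have b_nonneg: "0 \<le> b n" for n using nonneg by (simp add: step)
  show "summable (\<lambda>n. norm ((-1) ^ n * b n))"
    using b b_nonneg by (simp add: abs_mult power_abs)
  have "(\<Sum>i<n. (-1) ^ i * b i) = r 0 - (-1) ^ n * r n" for n
    by (induction n) (simp_all add: step algebra_simps)
  moreover have "(\<lambda>n. (-1) ^ n * r n) \<longlonglongrightarrow> 0"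
  proof (rule Lim_null_comparison[OF _ summable_LIMSEQ_zero[OF b]])
    show "\<forall>\<^sub>F n in sequentially. norm ((-1) ^ n * r n) \<le> b n"
      using nonneg by (intro always_eventually allI) (simp add: abs_mult power_abs step)
  qed
  then have "(\<lambda>n. r 0 - (-1) ^ n * r n) \<longlonglongrightarrow> r 0 - 0" by (intro tendsto_diff tendsto_const)
  ultimately show "(\<lambda>n. (-1) ^ n * b n) sums r 0" by (simp add: sums_def)
qed

text \<open>The orbit of \<open>\<sigma>\<close> under alternating use of the reflections \<open>\<sigma> \<mapsto> - \<sigma>\<close> (from even to following odd
indices) and \<open>\<sigma> \<mapsto> 2 - \<sigma>\<close> (from even to preceding odd indices), which fix the first and the second
exponent respectively.\<close>

definition reflection_orbit :: "real \<Rightarrow> int \<Rightarrow> real" where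
  "reflection_orbit \<sigma> n = (if even n then \<sigma> + of_int n else 1 - \<sigma> - of_int n)"

context wedge begin

text \<open>Starting with the transform at \<open>harmonic_q \<gamma> (2 - \<sigma>) = harmonic_q \<gamma> \<sigma>\<close>, each balance of exits
trades one transform for the other at the next point of the orbit, at the cost of one harmonic exponential.
All points visited lie outside the open interval from 0 to 1, where the balance holds.\<close>

lemma exit_transform1_alternating_sum:
  assumes "0 \<le> \<sigma>" "\<sigma> \<le> 1"
  shows "((\<lambda>n. (-1) ^ n * harmonic_exp \<gamma> x y (reflection_orbit \<sigma> (- int (Suc n)))) has_sum
     enn2real (exit_transform1 M W \<gamma> x y (harmonic_q \<gamma> \<sigma>))) UNIV"
proof -
  define a where "a n = reflection_orbit \<sigma> (- int (Suc n))" for n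
  \<comment> \<open>The remainder after \<open>n\<close> steps, up to sign.\<close>
  define r where "r n = enn2real (if even n then exit_transform1 M W \<gamma> x y (harmonic_q \<gamma> (a n)) else exit_transform2 M W \<gamma> x y (harmonic_p \<gamma> (a n)))" for n
  have a_even: "a n = real n + 2 - \<sigma>" if "even n" for n
    using that by (simp add: a_def reflection_orbit_def)
  have a_odd: "a n = \<sigma> - real n - 1" if "odd n" for n
    using that by (simp add: a_def reflection_orbit_def)
  have step: "harmonic_exp \<gamma> x y (a n) = r n + r (Suc n)" for n
  proof (cases "even n")
    case True
    then have "a (Suc n) = - a n" "1 \<le> a n" using assms by (simp_all add: a_even a_odd)
    then show ?thesis
      using exit_balance_real[of "a n"] True by (simp add: r_def harmonic_p_reflect)
  next
    case False
    then have "a (Suc n) = 2 - a n" "a n \<le> 0" using assms by (simp_all add: a_even a_odd)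
    then show ?thesis
      using exit_balance_real[of "a n"] False by (simp add: r_def harmonic_q_reflect)
  qed
  have "summable (\<lambda>n. harmonic_exp \<gamma> x y (a n))"
  proof (rule summable_comparison_test')
    let ?c = "exp (- (x + y) / 2)"
    show "summable (\<lambda>n. exp ((x + y) / 2) * ?c ^ n)"
      using xy by (intro summable_mult summable_geometric) simp
    show "norm (harmonic_exp \<gamma> x y (a n)) \<le> exp ((x + y) / 2) * ?c ^ n" for n
    proof -
      \<comment> \<open>The exponents decrease quadratically along the orbit; a linear bound suffices for comparison with a
        geometric series.\<close>
      have bd: "(c\<^sup>2 - d\<^sup>2) / 2 \<le> (1 - real n) / 2" if "0 \<le> c" "c \<le> 1" "real n \<le> \<bar>d\<bar>" for c d :: real
      proof -
        have "c\<^sup>2 \<le> 1" using that by (simp add: power_le_one)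
        moreover have "(real n)\<^sup>2 \<le> \<bar>d\<bar>\<^sup>2" using that by (intro power_mono) auto
        moreover have "real n \<le> (real n)\<^sup>2" by (cases n) (simp_all add: power2_eq_square)
        ultimately have "c\<^sup>2 - d\<^sup>2 \<le> 1 - real n" unfolding power2_abs by linarith
        then show ?thesis by simp
      qed
      have "harmonic_p \<gamma> (a n) \<le> (1 - real n) / 2" "harmonic_q \<gamma> (a n) \<le> (1 - real n) / 2"
        unfolding harmonic_p_def harmonic_q_def using \<gamma> assms
        by (intro bd; cases "even n"; simp add: a_even a_odd)+
      then have "harmonic_p \<gamma> (a n) * x + harmonic_q \<gamma> (a n) * y \<le> (1 - real n) / 2 * x + (1 - real n) / 2 * y"
        using xy by (intro add_mono mult_right_mono) auto
      also have "\<dots> = (x + y) / 2 + real n * (- (x + y) / 2)" by (simp add: field_simps)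
      finally show ?thesis
        by (simp add: harmonic_exp_def exp_of_nat_mult[symmetric] exp_add[symmetric] del: minus_add_distrib)
    qed
  qed
  from alternating_telescope_has_sum[of r, OF _ step this]
  have "((\<lambda>n. (-1) ^ n * harmonic_exp \<gamma> x y (a n)) has_sum r 0) UNIV" by (simp add: r_def)
  moreover have "r 0 = enn2real (exit_transform1 M W \<gamma> x y (harmonic_q \<gamma> \<sigma>))"
    using harmonic_q_reflect[of \<sigma>] by (simp add: r_def a_even)
  ultimately show ?thesis by (simp add: a_def)
qed

end

text \<open>The parameter of \<open>(p(\<alpha>), q(\<alpha>))\<close> on the parabola.  The right end point is separate because
\<open>tan (pi / 2)\<close> is 0 by convention.\<close>

definition angle_par :: "real \<Rightarrow> real" where
  "angle_par \<alpha> = (if \<alpha> = pi / 2 then 1 else tan \<alpha> / (1 + tan \<alpha>))"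

lemma angle_par_bounds:
  assumes "0 \<le> \<alpha>" "\<alpha> \<le> pi / 2" shows "0 \<le> angle_par \<alpha>" "angle_par \<alpha> \<le> 1"
proof -
  have "0 < tan \<alpha>" if "\<alpha> \<noteq> 0" "\<alpha> \<noteq> pi / 2" using that assms by (intro tan_gt_zero) auto
  then show "0 \<le> angle_par \<alpha>" "angle_par \<alpha> \<le> 1" by (cases "\<alpha> = 0"; auto simp: angle_par_def)+
qed

lemma p_par_eq_harmonic_p:
  assumes "0 \<le> \<alpha>" "\<alpha> \<le> pi / 2" shows "p_par \<gamma> \<alpha> = harmonic_p \<gamma> (angle_par \<alpha>)"
proof -
  have "p_par \<gamma> \<alpha> = harmonic_p \<gamma> (angle_par \<alpha>)" if "\<alpha> \<noteq> 0" "\<alpha> \<noteq> pi / 2"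
  proof -
    have t: "0 < tan \<alpha>" using that assms by (intro tan_gt_zero) auto
    then have "tan \<alpha> / (1 + tan \<alpha>) = 1 / (1 + 1 / tan \<alpha>)" by (simp add: field_simps)
    then show ?thesis using that t by (simp add: p_par_def harmonic_p_def angle_par_def power_divide field_simps)
  qed
  then show ?thesis by (cases "\<alpha> = 0"; cases "\<alpha> = pi / 2") (auto simp: p_par_def harmonic_p_def angle_par_def)
qed

lemma q_par_eq_harmonic_q:
  assumes "0 \<le> \<alpha>" "\<alpha> \<le> pi / 2" shows "q_par \<gamma> \<alpha> = harmonic_q \<gamma> (angle_par \<alpha>)"
proof -
  have "q_par \<gamma> \<alpha> = harmonic_q \<gamma> (angle_par \<alpha>)" if "\<alpha> \<noteq> 0" "\<alpha> \<noteq> pi / 2"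
  proof -
    have t: "0 < tan \<alpha>" using that assms by (intro tan_gt_zero) auto
    then have "1 - tan \<alpha> / (1 + tan \<alpha>) = 1 / (1 + tan \<alpha>)" by (simp add: field_simps)
    then show ?thesis using that t by (simp add: q_par_def harmonic_q_def angle_par_def power_divide field_simps)
  qed
  then show ?thesis
    by (cases "\<alpha> = 0"; cases "\<alpha> = pi / 2") (auto simp: q_par_def harmonic_q_def angle_par_def field_simps power2_eq_square)
qed

lemma angle_par_mirror:
  assumes "0 \<le> \<alpha>" "\<alpha> \<le> pi / 2" shows "angle_par (pi / 2 - \<alpha>) = 1 - angle_par \<alpha>"
proof -
  have "angle_par (pi / 2 - \<alpha>) = 1 - angle_par \<alpha>" if "\<alpha> \<noteq> 0" "\<alpha> \<noteq> pi / 2"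
  proof -
    have t: "0 < tan \<alpha>" using that assms by (intro tan_gt_zero) auto
    have tan': "tan (pi / 2 - \<alpha>) = 1 / tan \<alpha>" by (simp add: tan_cot inverse_eq_divide)
    have "angle_par (pi / 2 - \<alpha>) = tan (pi / 2 - \<alpha>) / (1 + tan (pi / 2 - \<alpha>))"
      using that by (simp add: angle_par_def)
    also have "\<dots> = 1 - tan \<alpha> / (1 + tan \<alpha>)"
      unfolding tan' using t by (simp add: field_simps)
    finally show ?thesis using that by (simp add: angle_par_def)
  qed
  moreover have "angle_par (pi / 2 - pi / 2) = 1 - angle_par (pi / 2)" by (simp add: angle_par_def)
  moreover have "angle_par (pi / 2 - 0) = 1 - angle_par 0" by (simp add: angle_par_def)
  ultimately show ?thesis by metis
qed

lemma p_seq_eq_harmonic_p: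
  assumes "0 \<le> \<alpha>" "\<alpha> \<le> pi / 2" shows "p_seq \<gamma> \<alpha> n = harmonic_p \<gamma> (reflection_orbit (angle_par \<alpha>) n)"
  by (cases "even n")
    (auto simp: p_seq_def p_even_def p_par_eq_harmonic_p[OF assms] q_par_eq_harmonic_q[OF assms] harmonic_p_def harmonic_q_def
      reflection_orbit_def field_simps power2_eq_square elim!: evenE oddE)

lemma q_seq_eq_harmonic_q:
  assumes "0 \<le> \<alpha>" "\<alpha> \<le> pi / 2" shows "q_seq \<gamma> \<alpha> n = harmonic_q \<gamma> (reflection_orbit (angle_par \<alpha>) n)"
  by (cases "even n")
    (auto simp: q_seq_def q_even_def p_par_eq_harmonic_p[OF assms] q_par_eq_harmonic_q[OF assms] harmonic_p_def harmonic_q_def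
      reflection_orbit_def field_simps power2_eq_square elim!: evenE oddE)

lemma reflection_orbit_mirror: "reflection_orbit (1 - \<sigma>) (- n) = 1 - reflection_orbit \<sigma> n"
  by (simp add: reflection_orbit_def)

lemma doob_transform_mirror:
  assumes "0 \<le> \<alpha>" "\<alpha> \<le> pi / 2" "doob_transform M W \<gamma> \<alpha> P"
  shows "doob_transform M (\<lambda>t \<omega>. - W t \<omega>) (1 - \<gamma>) (pi / 2 - \<alpha>) P"
proof -
  have \<alpha>': "0 \<le> pi / 2 - \<alpha>" "pi / 2 - \<alpha> \<le> pi / 2" using assms by auto
  have "p_par (1 - \<gamma>) (pi / 2 - \<alpha>) = q_par \<gamma> \<alpha>" "q_par (1 - \<gamma>) (pi / 2 - \<alpha>) = p_par \<gamma> \<alpha>"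
    by (simp_all add: p_par_eq_harmonic_p[OF \<alpha>'] q_par_eq_harmonic_q[OF \<alpha>'] p_par_eq_harmonic_p[OF assms(1,2)] q_par_eq_harmonic_q[OF assms(1,2)]
        angle_par_mirror[OF assms(1,2)] harmonic_p_mirror harmonic_q_mirror)
  then have "(p_par (1 - \<gamma>) (pi / 2 - \<alpha>), q_par (1 - \<gamma>) (pi / 2 - \<alpha>)) \<bullet> displacement (\<lambda>t \<omega>. - W t \<omega>) (1 - \<gamma>) t \<omega>
      = (p_par \<gamma> \<alpha>, q_par \<gamma> \<alpha>) \<bullet> displacement W \<gamma> t \<omega>" for t \<omega>
    by (simp add: displacement_def)
  with assms(3) show ?thesis
    unfolding doob_transform_def generated_sets_uminus by simp
qed

lemma L1_representation:
  fixes M :: "'a measure"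
  assumes "brownian_motion M W" "0 < \<gamma>" "\<gamma> < 1" "0 < x" "0 < y" and \<alpha>: "0 \<le> \<alpha>" "\<alpha> \<le> pi / 2"
  shows "doob_transform M W \<gamma> \<alpha> P \<Longrightarrow>
        L1 M W \<gamma> (x, y) (of_real (q_par \<gamma> \<alpha>)) =
          of_real (exp (p_par \<gamma> \<alpha> * x + q_par \<gamma> \<alpha> * y)
            * measure P {\<omega> \<in> space P. T1 W \<gamma> (x, y) \<omega> < T2 W \<gamma> (x, y) \<omega>})" (is "_ \<Longrightarrow> ?doob")
    and "((\<lambda>n. of_real ((-1) powi (n + 1) * exp (p_seq \<gamma> \<alpha> n * x + q_seq \<gamma> \<alpha> n * y))) has_sum
        L1 M W \<gamma> (x, y) (of_real (q_par \<gamma> \<alpha>))) {n::int. n \<le> -1}"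
proof -
  interpret wedge M W \<gamma> x y
    using assms by (auto simp: wedge_def wedge_axioms_def brownian_def brownian_axioms_def brownian_motion_def)
  let ?\<sigma> = "angle_par \<alpha>"
  note \<sigma> = angle_par_bounds[OF \<alpha>]
  have L1: "L1 M W \<gamma> (x, y) (of_real (q_par \<gamma> \<alpha>)) = of_real (enn2real (exit_transform1 M W \<gamma> x y (harmonic_q \<gamma> ?\<sigma>)))"
    unfolding q_par_eq_harmonic_q[OF \<alpha>] by (rule L1_eq_exit_transform1[OF \<sigma>(2)])
  show ?doob if "doob_transform M W \<gamma> \<alpha> P"
  proof -
    have "enn2real (exit_transform1 M W \<gamma> x y (harmonic_q \<gamma> ?\<sigma>)) = harmonic_exp \<gamma> x y ?\<sigma> * measure P {\<omega>\<in>space P. S \<omega> < T \<omega>}"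
      using that unfolding doob_transform_def p_par_eq_harmonic_p[OF \<alpha>] q_par_eq_harmonic_q[OF \<alpha>]
      by (intro exit_transform1_doob) blast+
    then show ?thesis
      by (simp only: L1) (simp add: harmonic_exp_def p_par_eq_harmonic_p[OF \<alpha>] q_par_eq_harmonic_q[OF \<alpha>])
  qed
  let ?f = "\<lambda>n. (-1) powi (n + 1) * exp (p_seq \<gamma> \<alpha> n * x + q_seq \<gamma> \<alpha> n * y)"
  have sgn: "(-1 :: real) powi (- int n) = (-1) ^ n" for n
    by (simp add: power_int_minus flip: power_inverse)
  have "bij_betw (\<lambda>n. - int (Suc n)) UNIV {n::int. n \<le> -1}"
    by (rule bij_betwI[where g = "\<lambda>m. nat (- m - 1)"]) auto
  moreover have "((\<lambda>n. ?f (- int (Suc n))) has_sum enn2real (exit_transform1 M W \<gamma> x y (harmonic_q \<gamma> ?\<sigma>))) UNIV"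
    using exit_transform1_alternating_sum[OF \<sigma>] unfolding harmonic_exp_def p_seq_eq_harmonic_p[OF \<alpha>] q_seq_eq_harmonic_q[OF \<alpha>]
    by (simp add: sgn)
  ultimately have "(?f has_sum enn2real (exit_transform1 M W \<gamma> x y (harmonic_q \<gamma> ?\<sigma>))) {n::int. n \<le> -1}"
    by (subst (asm) has_sum_reindex_bij_betw)
  then show "((\<lambda>n. of_real (?f n)) has_sum L1 M W \<gamma> (x, y) (of_real (q_par \<gamma> \<alpha>))) {n::int. n \<le> -1}"
    unfolding L1 by (rule has_sum_of_real)
qed

theorem proposition15:
  fixes M :: "'a measure" and W :: "real \<Rightarrow> 'a \<Rightarrow> real"
    and \<gamma> x0 y0 \<alpha> :: real
  assumes "brownian_motion M W"
    and "0 < \<gamma>" and "\<gamma> < 1"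
    and "0 < x0" and "0 < y0"
    and "0 \<le> \<alpha>" and "\<alpha> \<le> pi / 2"
  shows
    "(\<forall>P. doob_transform M W \<gamma> \<alpha> P \<longrightarrow>
        L1 M W \<gamma> (x0, y0) (of_real (q_par \<gamma> \<alpha>)) =
          of_real (exp (p_par \<gamma> \<alpha> * x0 + q_par \<gamma> \<alpha> * y0)
            * measure P {\<omega> \<in> space P. T1 W \<gamma> (x0, y0) \<omega> < T2 W \<gamma> (x0, y0) \<omega>})) \<and>
     ((\<lambda>n. of_real ((-1) powi (n + 1) * exp (p_seq \<gamma> \<alpha> n * x0 + q_seq \<gamma> \<alpha> n * y0))) has_sum
        L1 M W \<gamma> (x0, y0) (of_real (q_par \<gamma> \<alpha>))) {n::int. n \<le> -1} \<and>
     (\<forall>P. doob_transform M W \<gamma> \<alpha> P \<longrightarrow>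
        L2 M W \<gamma> (x0, y0) (of_real (p_par \<gamma> \<alpha>)) =
          of_real (exp (p_par \<gamma> \<alpha> * x0 + q_par \<gamma> \<alpha> * y0)
            * measure P {\<omega> \<in> space P. T2 W \<gamma> (x0, y0) \<omega> < T1 W \<gamma> (x0, y0) \<omega>})) \<and>
     ((\<lambda>n. of_real ((-1) powi (n + 1) * exp (p_seq \<gamma> \<alpha> n * x0 + q_seq \<gamma> \<alpha> n * y0))) has_sum
        L2 M W \<gamma> (x0, y0) (of_real (p_par \<gamma> \<alpha>))) {n::int. n \<ge> 1}"
proof -
  note \<alpha> = assms(6,7)
  have xy: "0 < x0 + y0" using assms by simp
  have \<alpha>': "0 \<le> pi / 2 - \<alpha>" "pi / 2 - \<alpha> \<le> pi / 2" using \<alpha> by auto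
  have \<gamma>': "0 < 1 - \<gamma>" "1 - \<gamma> < 1" using assms by auto
  have par: "p_par (1 - \<gamma>) (pi / 2 - \<alpha>) = q_par \<gamma> \<alpha>" "q_par (1 - \<gamma>) (pi / 2 - \<alpha>) = p_par \<gamma> \<alpha>"
    by (simp_all add: p_par_eq_harmonic_p[OF \<alpha>'] q_par_eq_harmonic_q[OF \<alpha>'] p_par_eq_harmonic_p[OF \<alpha>] q_par_eq_harmonic_q[OF \<alpha>]
        angle_par_mirror[OF \<alpha>] harmonic_p_mirror harmonic_q_mirror)
  have seq: "p_seq (1 - \<gamma>) (pi / 2 - \<alpha>) (- n) = q_seq \<gamma> \<alpha> n" "q_seq (1 - \<gamma>) (pi / 2 - \<alpha>) (- n) = p_seq \<gamma> \<alpha> n" for n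
    by (simp_all add: p_seq_eq_harmonic_p[OF \<alpha>'] q_seq_eq_harmonic_q[OF \<alpha>'] p_seq_eq_harmonic_p[OF \<alpha>] q_seq_eq_harmonic_q[OF \<alpha>]
        angle_par_mirror[OF \<alpha>] reflection_orbit_mirror harmonic_p_mirror harmonic_q_mirror)
  note half = L1_representation[OF assms]
  note half' = L1_representation[OF brownian_motion_uminus[OF assms(1)] \<gamma>' assms(5,4) \<alpha>',
      unfolded L1_mirror[OF xy] T1_mirror[OF xy] T2_mirror[OF xy] par]
  have doob2: "L2 M W \<gamma> (x0, y0) (of_real (p_par \<gamma> \<alpha>)) =
      of_real (exp (p_par \<gamma> \<alpha> * x0 + q_par \<gamma> \<alpha> * y0)
        * measure P {\<omega> \<in> space P. T2 W \<gamma> (x0, y0) \<omega> < T1 W \<gamma> (x0, y0) \<omega>})"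
    if "doob_transform M W \<gamma> \<alpha> P" for P
    using half'(1)[OF doob_transform_mirror[OF \<alpha> that]] by (simp only: add.commute)
  let ?f = "\<lambda>n. of_real ((-1) powi (n + 1) * exp (p_seq \<gamma> \<alpha> n * x0 + q_seq \<gamma> \<alpha> n * y0)) :: complex"
  have "bij_betw (\<lambda>n. - n) {n::int. n \<ge> 1} {n::int. n \<le> -1}"
    by (rule bij_betwI[where g = uminus]) auto
  from has_sum_reindex_bij_betw[OF this, THEN iffD2, OF half'(2)]
  have "((\<lambda>n. of_real ((-1) powi (- n + 1) * exp (q_seq \<gamma> \<alpha> n * y0 + p_seq \<gamma> \<alpha> n * x0)) :: complex) has_sum
        L2 M W \<gamma> (x0, y0) (of_real (p_par \<gamma> \<alpha>))) {n::int. n \<ge> 1}"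
    unfolding seq .
  moreover have "(-1 :: complex) powi (1 - n) = (-1) powi (n + 1)" for n :: int
    by (cases "even n") (simp_all add: power_int_minus_left)
  ultimately have "(?f has_sum L2 M W \<gamma> (x0, y0) (of_real (p_par \<gamma> \<alpha>))) {n::int. n \<ge> 1}"
    by (simp add: add.commute)
  with half doob2 show ?thesis by blast
qed

end
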